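(* For positive integers $n,d$ let $f_{n,d}$ be uniformly chosen from $\mathrm{Hom}(P_{n,d},0)$. There exist absolute constants $C,c>0$ such that for any positive integers $n$ and $d$, $$3+\big\lfloor c\sqrt{n2^{-d}}\big\rfloor-2^{1-n/2}\le \mathbb{E}\big[|\mathrm{Rng}(f_{n,d})|\big]\le 3+C\sqrt{n2^{-d}}.$$ Moreover, for any $\epsilon>0$ there exists $\delta>0$ such that for any positive integers $n$ and $d$, $$\mathbb{P}\Big(|\mathrm{Rng}(f_{n,d})|<3+\big\lfloor\delta\sqrt{n2^{-d}}\big\rfloor\Big)\le\epsilon+2^{1-n/2}.$$ In particular, if $d(n)$ is a sequence of positive integers with $d(n)-\log_2 n\to-\infty$ as $n\to\infty$, then for any positive integer $r$, $\mathbb{P}(|\mathrm{Rng}(f_{n,d(n)})|\le r)\to 0$ as $n\to\infty$.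
   Context: For $n,d\ge 1$, $P_{n,d}$ is the graph with vertex set $\{0,1,\dots,n\}$ in which $i,j$ are adjacent iff $|i-j|\in\{1,3,\dots,2d+1\}$. $\mathrm{Hom}(P_{n,d},0)$ is the finite set of functions $f\colon\{0,\dots,n\}\to\mathbb{Z}$ with $f(0)=0$ and $|f(i)-f(j)|=1$ whenever $i,j$ are adjacent in $P_{n,d}$. $\mathrm{Rng}(f)$ denotes the set of values taken by $f$, and $|\cdot|$ is cardinality. *)

theory Defs
  imports "HOL-Probability.Probability"
begin

definition P_verts :: "nat \<Rightarrow> nat set" where
  "P_verts n = {0..n}"

definition P_adj :: "nat \<Rightarrow> nat \<Rightarrow> nat \<Rightarrow> nat \<Rightarrow> bool" where
  "P_adj n d i j \<longleftrightarrow>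
     i \<in> P_verts n \<and> j \<in> P_verts n \<and> \<bar>int i - int j\<bar> \<in> {2 * int k + 1 | k. k \<le> d}"

text \<open>A function on the vertex set is represented by its unique extension that is
  \<^term>\<open>undefined\<close> elsewhere, so that distinct elements of the set below are
  distinct functions on the vertices and the set is finite.\<close>

definition Hom_P :: "nat \<Rightarrow> nat \<Rightarrow> (nat \<Rightarrow> int) set" where
  "Hom_P n d = {f \<in> P_verts n \<rightarrow>\<^sub>E (UNIV :: int set).
     f 0 = 0 \<and> (\<forall>i j. P_adj n d i j \<longrightarrow> \<bar>f i - f j\<bar> = 1)}"

definition Rng :: "nat \<Rightarrow> (nat \<Rightarrow> int) \<Rightarrow> int set" where
  "Rng n f = f ` P_verts n"

definition unif_Hom :: "nat \<Rightarrow> nat \<Rightarrow> (nat \<Rightarrow> int) pmf" where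
  "unif_Hom n d = pmf_of_set (Hom_P n d)"

text \<open>The next two facts are what makes \<^const>\<open>pmf_of_set\<close> the uniform distribution.\<close>

lemma finite_Hom_P: "finite (Hom_P n d)"
proof (rule finite_subset)
  show "finite (P_verts n \<rightarrow>\<^sub>E {- int n..int n})"
    by (simp add: P_verts_def finite_PiE)
  show "Hom_P n d \<subseteq> P_verts n \<rightarrow>\<^sub>E {- int n..int n}"
  proof
    fix f assume f: "f \<in> Hom_P n d"
    have "i \<le> n \<Longrightarrow> \<bar>f i\<bar> \<le> int i" for i
    proof (induction i)
      case 0
      show ?case using f by (simp add: Hom_P_def)
    next
      case (Suc i)
      have "P_adj n d (Suc i) i"
        using Suc.prems by (auto simp: P_adj_def P_verts_def intro!: exI[of _ "0::nat"])
      then have "\<bar>f (Suc i) - f i\<bar> = 1"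
        using f by (simp add: Hom_P_def)
      with Suc show ?case by simp
    qed
    then have "f i \<in> {- int n..int n}" if "i \<in> P_verts n" for i
      using that by (force simp: P_verts_def)
    then show "f \<in> P_verts n \<rightarrow>\<^sub>E {- int n..int n}"
      using f by (auto simp: Hom_P_def PiE_iff)
  qed
qed

lemma Hom_P_nonempty: "Hom_P n d \<noteq> {}"
proof -
  let ?f = "restrict (\<lambda>i. int i mod 2) (P_verts n)"
  have "\<bar>?f i - ?f j\<bar> = 1" if ij: "P_adj n d i j" for i j
  proof -
    obtain k where "\<bar>int i - int j\<bar> = 2 * int k + 1"
      using ij by (auto simp: P_adj_def)
    then have "\<bar>int i mod 2 - int j mod 2\<bar> = 1" by presburger
    then show ?thesis using ij by (simp add: P_adj_def)
  qed
  then have "?f \<in> Hom_P n d"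
    by (auto simp: Hom_P_def P_verts_def)
  then show ?thesis by blast
qed

end

theory Submission
  imports Defs "HOL-Real_Asymp.Real_Asymp"
begin

text \<open>
  Call \<open>i\<close> a turn of \<open>f\<close> if \<open>f (i + 2) \<noteq> f i\<close>. A \<open>\<plusminus>1\<close> path is a homomorphism iff any two
  turns of different parity are more than \<open>2 d\<close> apart. A maximal run of turns of one parity is a
  phase, during which \<open>f\<close> takes the values \<open>a - 1, a, a + 1\<close> for a fixed centre \<open>a\<close>; between
  consecutive phases the centre moves by \<open>\<plusminus>1\<close>. After the first turn, the turns are described
  uniquely by a sequence of free pairs (two places, the second carrying an arbitrary bit) and
  transitions (\<open>2 d + 1\<close> places). A free bit decides whether the next transitions go in the same
  or in the opposite direction. So the centre performs the walk \<open>\<Sum>i. \<sigma> i * L i\<close>, where \<open>L i\<close> is the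
  number of transitions between consecutive free pairs and, given \<open>L\<close>, the signs \<open>\<sigma> i\<close> are
  independent and uniform.

  The number \<open>R L\<close> of continuations satisfies \<open>R L = 2 R (L - 2) + R (L - 2 d - 1)\<close>. This
  recursion shows that \<open>\<Sum>i. (L i)\<^sup>2\<close> has mean at most \<open>n 2\<^sup>-\<^sup>d\<close>, which with Doob's maximal
  inequality yields the upper bound. It also shows that, up to an exponentially small
  probability, at least a constant multiple of \<open>n 2\<^sup>-\<^sup>d\<close> of the \<open>L i\<close> equal one; fixing all other
  signs, the central binomial coefficient bounds the probability that the walk ends in a given
  point, which yields the lower bounds. A range of fewer than three points occurs only for the two
  functions without turns.
\<close>

section \<open>Turns of a homomorphism\<close>

text \<open>A homomorphism \<open>f\<close> is encoded by its first step and the bits \<open>b ! i \<longleftrightarrow> f (i + 2) \<noteq> f i\<close>.\<close>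

definition valid :: "nat \<Rightarrow> bool list \<Rightarrow> bool" where
  "valid d b \<longleftrightarrow> (\<forall>i j. i < j \<longrightarrow> j < length b \<longrightarrow> b ! i \<longrightarrow> b ! j \<longrightarrow> odd (j - i) \<longrightarrow> 2 * d < j - i)"

text \<open>Place \<open>j\<close> of the list behind a turn is at distance \<open>j + 1\<close>
  from it, so opposite parity means even \<open>j\<close>, and the distance needed is
  \<open>k = 2 * d\<close>. A general \<open>k\<close> is kept because dropping two bits lowers the
  threshold by 2.\<close>

definition late :: "nat \<Rightarrow> bool list \<Rightarrow> bool" where
  "late k b \<longleftrightarrow> (\<forall>j < length b. b ! j \<longrightarrow> even j \<longrightarrow> k \<le> j)"

lemma valid_Nil [simp]: "valid d []"
  by (simp add: valid_def)

lemma late_Nil [simp]: "late k []"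
  by (simp add: late_def)

lemma valid_Cons: "valid d (c # b) \<longleftrightarrow> valid d b \<and> (c \<longrightarrow> late (2 * d) b)"
proof
  assume v: "valid d (c # b)"
  have "valid d b"
    unfolding valid_def
  proof (intro allI impI)
    fix i j assume "i < j" "j < length b" "b ! i" "b ! j" "odd (j - i)"
    then show "2 * d < j - i"
      using v[unfolded valid_def, rule_format, of "Suc i" "Suc j"] by simp
  qed
  moreover have "late (2 * d) b" if c
    unfolding late_def
  proof (intro allI impI)
    fix j assume "j < length b" "b ! j" "even j"
    then show "2 * d \<le> j"
      using v[unfolded valid_def, rule_format, of 0 "Suc j"] that by simp
  qed
  ultimately show "valid d b \<and> (c \<longrightarrow> late (2 * d) b)" by blast
next
  assume v: "valid d b \<and> (c \<longrightarrow> late (2 * d) b)"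
  show "valid d (c # b)"
    unfolding valid_def
  proof (intro allI impI)
    fix i j assume *: "i < j" "j < length (c # b)" "(c # b) ! i" "(c # b) ! j" "odd (j - i)"
    then obtain j' where j: "j = Suc j'" by (cases j) auto
    show "2 * d < j - i"
    proof (cases i)
      case 0
      then show ?thesis using * v j by (auto simp: late_def)
    next
      case (Suc i')
      then show ?thesis using * v j by (auto simp: valid_def)
    qed
  qed
qed

lemma late_Cons_Cons: "late k (c # c' # b) \<longleftrightarrow> (c \<longrightarrow> k = 0) \<and> late (k - 2) b"
proof -
  have "late k (c # c' # b) \<longleftrightarrow>
      (\<forall>j < Suc (Suc (length b)). (c # c' # b) ! j \<longrightarrow> even j \<longrightarrow> k \<le> j)"
    by (simp add: late_def)
  also have "\<dots> \<longleftrightarrow> (c \<longrightarrow> k = 0) \<and> (\<forall>j < length b. b ! j \<longrightarrow> even j \<longrightarrow> k \<le> Suc (Suc j))"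
    by (subst All_less_Suc2, subst All_less_Suc2) auto
  also have "\<dots> \<longleftrightarrow> (c \<longrightarrow> k = 0) \<and> late (k - 2) b"
    by (auto simp: late_def)
  finally show ?thesis .
qed

lemma late_mono: "late k b \<Longrightarrow> k' \<le> k \<Longrightarrow> late k' b"
  by (auto simp: late_def)

lemma late_replicate_even:
  "late k (replicate (2 * m) False @ b) \<longleftrightarrow> late (k - 2 * m) b"
proof (induction m arbitrary: k)
  case (Suc m)
  have "late k (replicate (2 * Suc m) False @ b) \<longleftrightarrow> late (k - 2) (replicate (2 * m) False @ b)"
    by (simp add: late_Cons_Cons)
  then show ?case by (simp add: Suc.IH)
qed simp

lemma valid_replicate [simp]: "valid d (replicate p False @ b) \<longleftrightarrow> valid d b"
  by (induction p) (auto simp: valid_Cons)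

text \<open>If the bits after a phase start do not begin with a free pair, the next phase
  starts at the earliest possible place.\<close>

lemma not_late_imp_next_phase:
  assumes d: "d > 0" and v: "valid d b" and l: "late (2 * d - 2) b" and n: "\<not> late (2 * d) b"
  shows "\<exists>b'. b = replicate (2 * d - 2) False @ True # b'"
proof -
  obtain j where j: "j < length b" "b ! j" "even j" "j < 2 * d"
    using n by (auto simp: late_def not_le)
  moreover have "2 * d - 2 \<le> j"
    using l j by (auto simp: late_def)
  ultimately have jd: "j = 2 * d - 2"
    by (elim evenE) auto
  have "\<not> b ! i" if i: "i < j" for i
  proof
    assume bi: "b ! i"
    show False
    proof (cases "even i")
      case True
      then have "2 * d - 2 \<le> i" using l i bi j unfolding late_def by (meson less_trans)
      then show False using i jd by simp
    next
      case False
      then have "odd (j - i)" using i j by simp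
      then have "2 * d < j - i" using v i bi j by (auto simp: valid_def)
      then show False using j by simp
    qed
  qed
  then have "take j b = replicate j False"
    using j by (auto intro!: nth_equalityI)
  moreover have "b = take j b @ b ! j # drop (Suc j) b"
    using j(1) by (rule id_take_nth_drop)
  ultimately show ?thesis using j(2) jd by metis
qed

text \<open>The bit \<open>c\<close> is next to the turn and must vanish; \<open>c'\<close> has the
  parity of the turn. Dropping both relaxes the threshold to \<open>2 * d - 2\<close>. Either the
  rest is still late enough, and \<open>c'\<close> is free, or it has a turn at the one newly
  allowed place, which is a transition and forces \<open>c'\<close> to vanish.\<close>

lemma valid_True_Cons_Cons:
  assumes d: "d > 0"
  shows "valid d (True # c # c' # b) \<longleftrightarrow>
    \<not> c \<and> (valid d (True # b) \<or>
      (\<not> c' \<and> (\<exists>b'. b = replicate (2 * d - 2) False @ True # b' \<and> valid d (True # b'))))"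
    (is "?l \<longleftrightarrow> \<not> c \<and> (?A \<or> ?B)")
proof -
  have l: "?l \<longleftrightarrow> \<not> c \<and> valid d b \<and> (c' \<longrightarrow> late (2 * d) b) \<and> late (2 * d - 2) b"
    using d by (auto simp: valid_Cons late_Cons_Cons)
  show ?thesis
  proof
    assume ?l
    then have *: "\<not> c" "valid d b" "c' \<longrightarrow> late (2 * d) b" "late (2 * d - 2) b"
      using l by auto
    show "\<not> c \<and> (?A \<or> ?B)"
    proof (cases "late (2 * d) b")
      case True
      then show ?thesis using * by (simp add: valid_Cons)
    next
      case False
      then obtain b' where b': "b = replicate (2 * d - 2) False @ True # b'"
        using not_late_imp_next_phase[OF d *(2,4)] by blast
      then have "valid d (True # b')" using *(2) by simp
      then show ?thesis using b' * False by blast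
    qed
  next
    assume r: "\<not> c \<and> (?A \<or> ?B)"
    show ?l
    proof (cases ?A)
      case True
      then show ?thesis using r l by (auto simp: valid_Cons intro: late_mono)
    next
      case False
      then obtain b' where b': "b = replicate (2 * (d - 1)) False @ True # b'"
        "valid d (True # b')" "\<not> c'" "\<not> c"
        using r by (auto simp: diff_mult_distrib2)
      have "late (2 * d - 2) b"
        unfolding b'(1) late_replicate_even by (simp add: late_def)
      then show ?thesis using l b' by simp
    qed
  qed
qed

text \<open>The possible bits following the first \<^const>\<open>True\<close> of a phase: either a pair whose second bit
  is free, or a transition to the next phase. The pairing makes the decomposition unique,
  since after a pair the bits are again those that may follow a start of a phase.\<close>

fun tails :: "nat \<Rightarrow> nat \<Rightarrow> bool list list" where
  [simp del]: "tails d L = (if L < 2 then [replicate L False] else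
     map (\<lambda>b. False # False # b) (tails d (L - 2)) @ map (\<lambda>b. False # True # b) (tails d (L - 2)) @
     (if 2 * d + 1 \<le> L then map (\<lambda>b. replicate (2 * d) False @ True # b) (tails d (L - (2 * d + 1)))
      else []))"

lemma replicate_double:
  assumes "d > 0"
  shows "replicate (2 * d) x = x # x # replicate (2 * d - 2) x"
  using assms by (cases d) auto

lemma set_tails:
  assumes d: "d > 0"
  shows "set (tails d L) = {b. length b = L \<and> valid d (True # b)}"
proof (induction L rule: less_induct)
  case (less L)
  show ?case
  proof (cases "L < 2")
    case True
    then have t: "tails d L = [replicate L False]" by (simp add: tails.simps)
    from True consider "L = 0" | "L = 1" by linarith
    then show ?thesis
      unfolding t using d by cases (auto simp: valid_Cons late_def length_Suc_conv)
  next
    case False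
    have len2: "length b = L \<longleftrightarrow> (\<exists>c c' b'. b = c # c' # b' \<and> length b' = L - 2)" for b :: "bool list"
    proof -
      obtain M where "L = Suc (Suc M)" using False by (metis One_nat_def Suc_1 add_2_eq_Suc le_add_diff_inverse not_less)
      then show ?thesis by (auto simp: length_Suc_conv)
    qed
    note rep = replicate_double[OF d]
    have ex: "{b. length b = L \<and> valid d (True # b)} =
       (\<lambda>b. False # False # b) ` {b. length b = L - 2 \<and> valid d (True # b)} \<union>
       (\<lambda>b. False # True # b) ` {b. length b = L - 2 \<and> valid d (True # b)} \<union>
       (if 2 * d + 1 \<le> L then (\<lambda>b. replicate (2 * d) False @ True # b) `
          {b. length b = L - (2 * d + 1) \<and> valid d (True # b)} else {})"
      (is "?l = ?r")
    proof (intro set_eqI iffI)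
      fix b assume "b \<in> ?l"
      then obtain c c' b' where b: "b = c # c' # b'" "length b' = L - 2"
        "valid d (True # c # c' # b')"
        using len2 by auto
      then consider "\<not> c" "valid d (True # b')" | b'' where "\<not> c" "\<not> c'"
        "b' = replicate (2 * d - 2) False @ True # b''" "valid d (True # b'')"
        using valid_True_Cons_Cons[OF d, of c c' b'] by blast
      then show "b \<in> ?r"
      proof cases
        case 1
        then show ?thesis using b by (cases c') auto
      next
        case 2
        then have "2 * d + 1 \<le> L" "length b'' = L - (2 * d + 1)" using b False d by auto
        then have "b = replicate (2 * d) False @ True # b''"
          using b 2 by (simp add: rep)
        then show ?thesis using 2 \<open>2 * d + 1 \<le> L\<close> \<open>length b'' = L - (2 * d + 1)\<close> by auto
      qed
    next
      fix b assume "b \<in> ?r"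
      then consider b' where "b = False # False # b'" "length b' = L - 2" "valid d (True # b')"
        | b' where "b = False # True # b'" "length b' = L - 2" "valid d (True # b')"
        | b' where "b = replicate (2 * d) False @ True # b'" "2 * d + 1 \<le> L"
            "length b' = L - (2 * d + 1)" "valid d (True # b')"
        by (auto split: if_splits)
      then show "b \<in> ?l"
      proof cases
        case 3
        then have "valid d (True # b)"
          unfolding rep 3(1) append_Cons valid_True_Cons_Cons[OF d] by blast
        then show ?thesis using 3 by simp
      qed (use False valid_True_Cons_Cons[OF d] in auto)
    qed
    have "set (tails d (L - 2)) = {b. length b = L - 2 \<and> valid d (True # b)}"
      using False by (intro less.IH) auto
    moreover have "set (tails d (L - (2 * d + 1))) = {b. length b = L - (2 * d + 1) \<and> valid d (True # b)}"
      using False by (intro less.IH) auto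
    ultimately show ?thesis
      using False unfolding ex by (subst tails.simps) (simp add: Un_assoc)
  qed
qed

lemma distinct_tails:
  assumes d: "d > 0"
  shows "distinct (tails d L)"
proof (induction L rule: less_induct)
  case (less L)
  show ?case
  proof (cases "L < 2")
    case True
    then show ?thesis by (simp add: tails.simps)
  next
    case False
    note rep = replicate_double[OF d]
    \<comment> \<open>A pair with free bit False and a transition both begin with two False bits.
      They differ because the rest of a transition has a turn too early to be a tail.\<close>
    have "\<not> valid d (True # replicate (2 * d - 2) False @ True # b)" for b
    proof
      assume "valid d (True # replicate (2 * d - 2) False @ True # b)"
      then have "late (2 * d) (replicate (2 * (d - 1)) False @ True # b)"
        by (simp add: valid_Cons diff_mult_distrib2)
      then show False
        unfolding late_replicate_even using d by (auto simp: late_def)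
    qed
    moreover have "distinct (tails d (L - 2))" "distinct (tails d (L - (2 * d + 1)))"
      using False by (auto intro: less.IH)
    ultimately show ?thesis
      using False
      by (subst tails.simps, unfold rep append_Cons)
        (auto simp: distinct_map inj_on_def set_tails[OF d])
  qed
qed

text \<open>Cutting a tail at its free pairs gives blocks of consecutive transitions, of lengths \<open>Ls\<close>.
  All transitions of a block have the same direction, and a free bit decides whether the next
  block reverses it; so the directions of the blocks are arbitrary signs.\<close>

fun inc :: "nat list \<Rightarrow> nat list" where
  "inc [] = []"
| "inc (l # Ls) = Suc l # Ls"

text \<open>There is always a block after the last pair, possibly an empty one, since its sign
  encodes the free bit of that pair.\<close>

fun blks :: "nat \<Rightarrow> nat \<Rightarrow> nat list list" where
  [simp del]: "blks d L = (if L < 2 then [[0]] else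
     map ((#) 0) (blks d (L - 2)) @
     (if 2 * d + 1 \<le> L then map inc (blks d (L - (2 * d + 1))) else []))"

fun sgns :: "nat list \<Rightarrow> (int \<times> nat) list list" where
  "sgns [] = [[]]"
| "sgns (l # Ls) = map ((#) (1, l)) (sgns Ls) @ map ((#) (-1, l)) (sgns Ls)"

text \<open>A pair steps back to the centre and then to the side given by the sign of the next
  block; the second step is a turn exactly if the sign changes. The value \<open>[]\<close> for
  \<open>zs = []\<close> is a mere default, as block lists are nonempty.\<close>

fun enc :: "nat \<Rightarrow> nat \<Rightarrow> (int \<times> nat) list \<Rightarrow> bool list" where
  [simp del]: "enc d L zs = (if L < 2 then replicate L False else
     case zs of [] \<Rightarrow> []
     | (\<sigma>, l) # zs' \<Rightarrow>
        (case l of 0 \<Rightarrow> False # (fst (hd zs') \<noteq> \<sigma>) # enc d (L - 2) zs'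
         | Suc l' \<Rightarrow> replicate (2 * d) False @ True # enc d (L - (2 * d + 1)) ((\<sigma>, l') # zs')))"

lemma blks_nonempty: "Ls \<in> set (blks d L) \<Longrightarrow> Ls \<noteq> []"
proof (induction L arbitrary: Ls rule: less_induct)
  case (less L)
  have "inc Ls = [] \<longleftrightarrow> Ls = []" for Ls by (cases Ls) auto
  then show ?case
    using less.prems less.IH[of "L - (2 * d + 1)"]
    by (subst (asm) blks.simps) (fastforce split: if_splits)
qed

lemma sum_list_blks:
  fixes \<phi> :: "nat list \<Rightarrow> real"
  shows "(\<Sum>Ls\<leftarrow>blks d L. \<phi> Ls) = (if L < 2 then \<phi> [0] else
     (\<Sum>Ls\<leftarrow>blks d (L - 2). \<phi> (0 # Ls)) +
     (if 2 * d + 1 \<le> L then (\<Sum>Ls\<leftarrow>blks d (L - (2 * d + 1)). \<phi> (inc Ls)) else 0))"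
  by (subst blks.simps) (simp add: o_def)

lemma sum_list_tails:
  fixes \<phi> :: "bool list \<Rightarrow> real"
  shows "(\<Sum>b\<leftarrow>tails d L. \<phi> b) = (if L < 2 then \<phi> (replicate L False) else
     (\<Sum>b\<leftarrow>tails d (L - 2). \<phi> (False # False # b) + \<phi> (False # True # b)) +
     (if 2 * d + 1 \<le> L then
       (\<Sum>b\<leftarrow>tails d (L - (2 * d + 1)). \<phi> (replicate (2 * d) False @ True # b)) else 0))"
  by (subst tails.simps) (simp add: o_def sum_list_addf)

lemma sum_list_sgns_Cons:
  fixes \<phi> :: "(int \<times> nat) list \<Rightarrow> real"
  shows "(\<Sum>zs\<leftarrow>sgns (l # Ls). \<phi> zs) = (\<Sum>zs\<leftarrow>sgns Ls. \<phi> ((1, l) # zs) + \<phi> ((-1, l) # zs))"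
  by (simp add: o_def sum_list_addf)

lemma map_snd_sgns: "zs \<in> set (sgns Ls) \<Longrightarrow> map snd zs = Ls"
  by (induction Ls arbitrary: zs) auto

lemma fst_sgns: "zs \<in> set (sgns Ls) \<Longrightarrow> z \<in> set zs \<Longrightarrow> fst z = 1 \<or> fst z = -1"
  by (induction Ls arbitrary: zs) auto

lemma sum_list_cong: "(\<And>x. x \<in> set xs \<Longrightarrow> f x = g x) \<Longrightarrow> (\<Sum>x\<leftarrow>xs. f x) = (\<Sum>x\<leftarrow>xs. g x :: real)"
  by (metis (mono_tags, lifting) map_eq_conv)

text \<open>A counting form of the bijection between tails with an initial direction and signed
  block lists. The test function stays arbitrary in the induction because removing a pair or a
  transition changes it.\<close>

lemma sum_tails_eq_sum_blks:
  fixes \<phi> :: "int \<Rightarrow> bool list \<Rightarrow> real"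
  shows "(\<Sum>b\<leftarrow>tails d L. \<phi> 1 b + \<phi> (-1) b) =
    (\<Sum>Ls\<leftarrow>blks d L. \<Sum>zs\<leftarrow>sgns Ls. \<phi> (fst (hd zs)) (enc d L zs))"
proof (induction L arbitrary: \<phi> rule: less_induct)
  case (less L)
  show ?case
  proof (cases "L < 2")
    case True
    then show ?thesis by (simp add: sum_list_tails sum_list_blks enc.simps)
  next
    case False
    \<comment> \<open>Given the sign \<open>\<tau>\<close> of the next block, each current sign
      determines the free bit. Gathering both current signs turns the free bit into a free
      sign.\<close>
    define \<psi> where "\<psi> \<tau> b = \<phi> 1 (False # (\<tau> \<noteq> 1) # b) + \<phi> (-1) (False # (\<tau> \<noteq> -1) # b)"
      for \<tau> :: int and b
    have 1: "(\<Sum>b\<leftarrow>tails d (L - 2). \<phi> 1 (False # False # b) + \<phi> (-1) (False # False # b) +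
        (\<phi> 1 (False # True # b) + \<phi> (-1) (False # True # b))) =
      (\<Sum>Ls\<leftarrow>blks d (L - 2). \<Sum>zs\<leftarrow>sgns (0 # Ls). \<phi> (fst (hd zs)) (enc d L zs))"
    proof -
      have "(\<Sum>b\<leftarrow>tails d (L - 2). \<psi> 1 b + \<psi> (-1) b) =
          (\<Sum>Ls\<leftarrow>blks d (L - 2). \<Sum>zs\<leftarrow>sgns Ls. \<psi> (fst (hd zs)) (enc d (L - 2) zs))"
        using False by (intro less.IH) auto
      also have "\<dots> = (\<Sum>Ls\<leftarrow>blks d (L - 2). \<Sum>zs\<leftarrow>sgns (0 # Ls). \<phi> (fst (hd zs)) (enc d L zs))"
        unfolding sum_list_sgns_Cons \<psi>_def using False
        by (intro sum_list_cong) (simp add: enc.simps[of d L])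
      finally show ?thesis by (simp add: \<psi>_def algebra_simps)
    qed
    have 2: "(\<Sum>b\<leftarrow>tails d (L - (2 * d + 1)). \<phi> 1 (replicate (2 * d) False @ True # b) +
        \<phi> (-1) (replicate (2 * d) False @ True # b)) =
      (\<Sum>Ls\<leftarrow>blks d (L - (2 * d + 1)). \<Sum>zs\<leftarrow>sgns (inc Ls). \<phi> (fst (hd zs)) (enc d L zs))"
    proof -
      have "(\<Sum>b\<leftarrow>tails d (L - (2 * d + 1)). \<phi> 1 (replicate (2 * d) False @ True # b) +
        \<phi> (-1) (replicate (2 * d) False @ True # b)) =
        (\<Sum>Ls\<leftarrow>blks d (L - (2 * d + 1)). \<Sum>zs\<leftarrow>sgns Ls. \<phi> (fst (hd zs))
          (replicate (2 * d) False @ True # enc d (L - (2 * d + 1)) zs))"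
        using False by (intro less.IH[of _ "\<lambda>\<sigma> b. \<phi> \<sigma> (replicate (2 * d) False @ True # b)"]) auto
      also have "\<dots> = (\<Sum>Ls\<leftarrow>blks d (L - (2 * d + 1)). \<Sum>zs\<leftarrow>sgns (inc Ls). \<phi> (fst (hd zs)) (enc d L zs))"
      proof (rule sum_list_cong)
        fix Ls assume "Ls \<in> set (blks d (L - (2 * d + 1)))"
        then have "Ls \<noteq> []" by (rule blks_nonempty)
        then obtain l Ls' where "Ls = l # Ls'" by (cases Ls) auto
        then show "(\<Sum>zs\<leftarrow>sgns Ls. \<phi> (fst (hd zs)) (replicate (2 * d) False @ True # enc d (L - (2 * d + 1)) zs))
          = (\<Sum>zs\<leftarrow>sgns (inc Ls). \<phi> (fst (hd zs)) (enc d L zs))"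
          using False by (simp add: sum_list_sgns_Cons enc.simps[of d L] del: sgns.simps)
      qed
      finally show ?thesis .
    qed
    have "(\<Sum>b\<leftarrow>tails d L. \<phi> 1 b + \<phi> (-1) b) =
      (\<Sum>Ls\<leftarrow>blks d (L - 2). \<Sum>zs\<leftarrow>sgns (0 # Ls). \<phi> (fst (hd zs)) (enc d L zs)) +
      (if 2 * d + 1 \<le> L then (\<Sum>Ls\<leftarrow>blks d (L - (2 * d + 1)). \<Sum>zs\<leftarrow>sgns (inc Ls).
        \<phi> (fst (hd zs)) (enc d L zs)) else 0)"
      using False unfolding sum_list_tails[of _ _ L] 1 2 by simp
    also have "\<dots> = (\<Sum>Ls\<leftarrow>blks d L. \<Sum>zs\<leftarrow>sgns Ls. \<phi> (fst (hd zs)) (enc d L zs))"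
      using False unfolding sum_list_blks[of _ _ L] by simp
    finally show ?thesis .
  qed
qed

section \<open>All admissible bit lists, split by their first turn\<close>

fun alls :: "nat \<Rightarrow> nat \<Rightarrow> bool list list" where
  "alls d 0 = [[]]"
| "alls d (Suc N) = map ((#) False) (alls d N) @ map ((#) True) (tails d N)"

lemma set_alls:
  assumes d: "d > 0"
  shows "set (alls d N) = {b. length b = N \<and> valid d b}"
proof (induction N)
  case (Suc N)
  have eq: "{b. length b = Suc N \<and> valid d b} = (#) False ` {b. length b = N \<and> valid d b} \<union>
      (#) True ` {b. length b = N \<and> valid d (True # b)}" (is "?l = ?r")
  proof (intro set_eqI iffI)
    fix b assume "b \<in> ?l"
    then obtain c b' where "b = c # b'" "length b' = N" "valid d (c # b')"
      by (cases b) auto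
    then show "b \<in> ?r" by (cases c) (auto simp: valid_Cons[of d False b'])
  next
    fix b assume "b \<in> ?r"
    then show "b \<in> ?l" by (auto simp: valid_Cons)
  qed
  show ?case
    unfolding eq by (simp add: Suc.IH set_tails[OF d])
qed auto

lemma distinct_alls: "d > 0 \<Longrightarrow> distinct (alls d N)"
  by (induction N) (auto simp: distinct_map distinct_tails)

lemma sum_alls:
  fixes \<phi> :: "bool list \<Rightarrow> real"
  shows "(\<Sum>b\<leftarrow>alls d N. \<phi> b) = \<phi> (replicate N False) +
    (\<Sum>p<N. \<Sum>b\<leftarrow>tails d (N - 1 - p). \<phi> (replicate p False @ True # b))"
proof (induction N arbitrary: \<phi>)
  case (Suc N)
  have "(\<Sum>b\<leftarrow>alls d (Suc N). \<phi> b) =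
      (\<Sum>b\<leftarrow>alls d N. \<phi> (False # b)) + (\<Sum>b\<leftarrow>tails d N. \<phi> (True # b))"
    by (simp add: o_def)
  also have "(\<Sum>b\<leftarrow>alls d N. \<phi> (False # b)) = \<phi> (False # replicate N False) +
    (\<Sum>p<N. \<Sum>b\<leftarrow>tails d (N - 1 - p). \<phi> (False # replicate p False @ True # b))"
    by (rule Suc.IH)
  finally show ?case
    unfolding sum.lessThan_Suc_shift by simp
qed simp

section \<open>The correspondence with homomorphisms\<close>

text \<open>Here \<open>s\<close> is the last step before \<open>x\<close>; thus \<open>walk 0 s (True # b)\<close> is the list of values of
  the function with first step \<open>s\<close> and bits \<open>b\<close>.\<close>

fun walk :: "int \<Rightarrow> int \<Rightarrow> bool list \<Rightarrow> int list" where
  "walk x s [] = [x]"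
| "walk x s (c # b) = x # walk (x + (if c then s else - s)) (if c then s else - s) b"

lemma length_walk [simp]: "length (walk x s b) = Suc (length b)"
  by (induction b arbitrary: x s) auto

lemma walk_nth_0 [simp]: "walk x s b ! 0 = x"
  by (cases b) auto

lemma walk_step:
  "i < length b \<Longrightarrow>
    walk x s b ! Suc i - walk x s b ! i = s * (\<Prod>j\<le>i. if b ! j then 1 else -1)"
proof (induction b arbitrary: i x s)
  case (Cons c b)
  show ?case
  proof (cases i)
    case (Suc i')
    then have "walk x s (c # b) ! Suc i - walk x s (c # b) ! i =
        (if c then s else - s) * (\<Prod>j\<le>i'. if b ! j then 1 else -1)"
      using Cons.prems by (simp only: walk.simps nth_Cons_Suc) (rule Cons.IH, simp)
    also have "\<dots> = s * (\<Prod>j\<le>i. if (c # b) ! j then 1 else -1)"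
      unfolding Suc prod.atMost_Suc_shift by simp
    finally show ?thesis .
  qed simp
qed simp

lemma abs_prod_signs: "\<bar>\<Prod>j\<in>A. if P j then 1 else (-1::int)\<bar> = 1"
  by (simp add: abs_prod if_distrib cong: if_cong)

section \<open>Adjacency conditions and the spacing of turns\<close>

lemma Hom_P_adjacent:
  assumes f: "f \<in> Hom_P n d" and "i \<le> n" "j \<le> n" "odd (int i - int j)" "\<bar>int i - int j\<bar> \<le> 2 * int d + 1"
  shows "\<bar>f i - f j\<bar> = 1"
proof -
  have "odd \<bar>int i - int j\<bar>" using assms by simp
  then obtain k where k: "\<bar>int i - int j\<bar> = 2 * k + 1" by (rule oddE)
  then have "0 \<le> k" "k \<le> int d" using assms by auto
  then have "P_adj n d i j"
    using assms k unfolding P_adj_def P_verts_def by (auto intro!: exI[of _ "nat k"])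
  then show ?thesis using f by (simp add: Hom_P_def)
qed

lemma Hom_P_step: "f \<in> Hom_P n d \<Longrightarrow> i < n \<Longrightarrow> \<bar>f (Suc i) - f i\<bar> = 1"
  by (rule Hom_P_adjacent) auto

text \<open>Otherwise \<open>i\<close> and \<open>i + 2\<close> are both adjacent to \<open>j\<close> and \<open>j + 2\<close>, but then both
  \<open>f i\<close> and \<open>f (i + 2)\<close> are the midpoint of \<open>f j \<noteq> f (j + 2)\<close>.\<close>

lemma Hom_P_turns_apart:
  assumes f: "f \<in> Hom_P n d" and ij: "i < j" "j + 2 \<le> n" "f (i + 2) \<noteq> f i" "f (j + 2) \<noteq> f j"
    and odd: "odd (j - i)"
  shows "2 * d < j - i"
proof (rule ccontr)
  assume c: "\<not> 2 * d < j - i"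
  have "j - i \<noteq> 2 * d" using odd by (metis dvd_triv_left)
  then have le: "j - i + 1 \<le> 2 * d" using c by linarith
  have "int j - int i = int (j - i)" using ij by simp
  then have o: "odd (int j - int i)" using odd by (simp only: even_of_nat) simp
  have "\<bar>f i - f j\<bar> = 1" "\<bar>f i - f (j + 2)\<bar> = 1" "\<bar>f (i + 2) - f j\<bar> = 1" "\<bar>f (i + 2) - f (j + 2)\<bar> = 1"
    using ij le o by (auto intro!: Hom_P_adjacent[OF f])
  then show False using ij(3,4) by linarith
qed

lemma const_of_no_turns:
  fixes f :: "nat \<Rightarrow> int"
  assumes "\<And>l. l < k \<Longrightarrow> f (i + 2 * l + 2) = f (i + 2 * l)"
  shows "f (i + 2 * k) = f i"
  using assms by (induction k) auto

text \<open>Turns of both parities do not fit between \<open>i\<close> and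
  \<open>i + 2 * k + 1\<close>. So either \<open>f\<close> is constant on the even offsets or on the
  odd ones, and in both cases a single step remains.\<close>

lemma adjacent_of_turns_apart:
  fixes f :: "nat \<Rightarrow> int"
  assumes step: "\<And>i. i < n \<Longrightarrow> \<bar>f (Suc i) - f i\<bar> = 1"
    and apart: "\<And>i j. i < j \<Longrightarrow> j + 2 \<le> n \<Longrightarrow> f (i + 2) \<noteq> f i \<Longrightarrow> f (j + 2) \<noteq> f j \<Longrightarrow>
      odd (j - i) \<Longrightarrow> 2 * d < j - i"
    and k: "k \<le> d" "i + 2 * k + 1 \<le> n"
  shows "\<bar>f (i + 2 * k + 1) - f i\<bar> = 1"
proof (cases "\<forall>l<k. f (i + 2 * l + 2) = f (i + 2 * l)")
  case True
  then have "f (i + 2 * k) = f i" by (intro const_of_no_turns) auto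
  then show ?thesis using step[of "i + 2 * k"] k by simp
next
  case False
  then obtain l where l: "l < k" "f (i + 2 * l + 2) \<noteq> f (i + 2 * l)" by auto
  have "f (Suc i + 2 * m + 2) = f (Suc i + 2 * m)" if m: "m < k" for m
  proof (rule ccontr)
    assume t: "f (Suc i + 2 * m + 2) \<noteq> f (Suc i + 2 * m)"
    show False
    proof (cases "l \<le> m")
      case True
      have "odd (Suc i + 2 * m - (i + 2 * l))"
        using True by (simp add: Suc_diff_le)
      then show False using apart[of "i + 2 * l" "Suc i + 2 * m"] l t True k m by simp
    next
      case False
      have "i + 2 * l - (Suc i + 2 * m) = 2 * (l - m - 1) + 1"
        using False by simp
      then have "odd (i + 2 * l - (Suc i + 2 * m))" by simp
      then show False using apart[of "Suc i + 2 * m" "i + 2 * l"] l t False k m by simp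
    qed
  qed
  then have "f (Suc i + 2 * k) = f (Suc i)" by (intro const_of_no_turns) auto
  then show ?thesis using step[of i] k by simp
qed

lemma bij_betw_Hom_P:
  assumes n: "n > 0"
  shows "bij_betw (\<lambda>(s, b). \<lambda>i\<in>P_verts n. walk 0 s (True # b) ! i)
    ({1, -1} \<times> {b. length b = n - 1 \<and> valid d b}) (Hom_P n d)"
proof -
  define path where "path s b = (\<lambda>i\<in>P_verts n. walk 0 s (True # b) ! i)" for s b
  define code where "code f = (f 1 :: int, map (\<lambda>i. f (i + 2) \<noteq> f i) [0..<n - 1])" for f :: "nat \<Rightarrow> int"
  \<comment> \<open>The step from \<open>i\<close> to \<open>i + 1\<close>: it repeats the previous
    step at a turn and reverses it otherwise. The leading True makes the first step equal to
    \<open>s\<close>.\<close>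
  define e where "e s b i = s * (\<Prod>j\<le>i. if (True # b) ! j then 1 else (-1::int))" for s :: int and b i
  let ?D = "{1, -1 :: int} \<times> {b. length b = n - 1 \<and> valid d b}"
  have path_step: "path s b (Suc i) - path s b i = e s b i" if "length b = n - 1" "i < n" for s b i
    unfolding path_def e_def using that by (simp add: P_verts_def walk_step del: walk.simps)
  have path_0: "path s b 0 = 0" for s b
    by (simp add: path_def P_verts_def del: walk.simps)
  have e_Suc: "e s b (Suc i) = e s b i * (if b ! i then 1 else -1)" for s b i
    by (simp add: e_def)
  have e_abs: "\<bar>e s b i\<bar> = 1" if "s \<in> {1, -1}" for s b i
    using that abs_prod_signs[of "\<lambda>j. (True # b) ! j" "{..i}"] by (auto simp: e_def abs_mult)
  have path_turn: "path s b (i + 2) \<noteq> path s b i \<longleftrightarrow> b ! i"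
    if "length b = n - 1" "i + 2 \<le> n" "s \<in> {1, -1}" for s b i
    using path_step[OF that(1), of i s] path_step[OF that(1), of "Suc i" s] that e_abs[OF that(3), of b i]
      e_Suc[of s b i]
    by (auto split: if_splits)
  have code_path: "code (path s b) = (s, b)" if "(s, b) \<in> ?D" for s b
  proof -
    have "path s b 1 = s"
      using path_step[of b 0 s] that n path_0[of s b] by (simp add: e_def)
    moreover have "map (\<lambda>i. path s b (i + 2) \<noteq> path s b i) [0..<n - 1] = b"
    proof (rule nth_equalityI)
      fix i assume "i < length (map (\<lambda>i. path s b (i + 2) \<noteq> path s b i) [0..<n - 1])"
      then show "map (\<lambda>i. path s b (i + 2) \<noteq> path s b i) [0..<n - 1] ! i = b ! i"
        using path_turn[of b i s] that by simp
    qed (use that in simp)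
    ultimately show ?thesis by (simp add: code_def)
  qed
  have path_Hom: "path s b \<in> Hom_P n d" if sb: "(s, b) \<in> ?D" for s b
  proof -
    have st: "\<bar>path s b (Suc i) - path s b i\<bar> = 1" if "i < n" for i
      using path_step[of b i s] e_abs[of s b i] sb that by auto
    have ap: "2 * d < j - i"
      if "i < j" "j + 2 \<le> n" "path s b (i + 2) \<noteq> path s b i" "path s b (j + 2) \<noteq> path s b j" "odd (j - i)"
      for i j
      using that sb path_turn[of b i s] path_turn[of b j s] by (auto simp: valid_def)
    have ad: "\<bar>path s b i - path s b j\<bar> = 1" if a: "P_adj n d i j" and ji: "j < i" for i j
    proof -
      obtain k where k: "k \<le> d" "int i - int j = 2 * int k + 1" "i \<le> n"
        using a ji by (force simp: P_adj_def P_verts_def)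
      then have i: "i = j + 2 * k + 1" by linarith
      then show ?thesis using adjacent_of_turns_apart[where f = "path s b" and n = n, OF st ap, where k = k and i = j] k unfolding i by simp
    qed
    have "\<bar>path s b i - path s b j\<bar> = 1" if a: "P_adj n d i j" for i j
    proof (cases "j < i")
      case False
      have "i \<noteq> j" using a by (auto simp: P_adj_def)
      moreover have "P_adj n d j i" using a by (auto simp: P_adj_def abs_minus_commute)
      ultimately show ?thesis using ad[of j i] False by (simp add: abs_minus_commute)
    qed (use ad a in blast)
    then show ?thesis
      using path_0 by (auto simp: Hom_P_def path_def)
  qed
  have code_D: "code f \<in> ?D" if f: "f \<in> Hom_P n d" for f
  proof -
    have "f 1 \<in> {1, -1}" using Hom_P_step[OF f, of 0] n f by (auto simp: Hom_P_def)
    moreover have "valid d (snd (code f))"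
      using Hom_P_turns_apart[OF f] by (auto simp: valid_def code_def)
    ultimately show ?thesis by (simp add: code_def)
  qed
  have path_code: "path (fst (code f)) (snd (code f)) = f" if f: "f \<in> Hom_P n d" for f
  proof -
    define s b where "s = fst (code f)" and "b = snd (code f)"
    have len: "length b = n - 1" by (simp add: b_def code_def)
    have D: "(s, b) \<in> ?D" using code_D[OF f] by (simp add: s_def b_def)
    have f0: "f 0 = 0" using f by (simp add: Hom_P_def)
    have fe: "f (Suc i) - f i = e s b i" if "i < n" for i
      using that
    proof (induction i)
      case 0
      then show ?case using f0 by (simp add: e_def s_def code_def)
    next
      case (Suc i)
      then have "f (Suc i) - f i = e s b i" by simp
      moreover have "b ! i \<longleftrightarrow> f (Suc (Suc i)) \<noteq> f i"
      proof -
        have "i < n - 1" using Suc.prems by simp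
        then show ?thesis by (simp add: b_def code_def)
      qed
      moreover have "\<bar>f (Suc (Suc i)) - f (Suc i)\<bar> = 1" "\<bar>f (Suc i) - f i\<bar> = 1"
        using Suc.prems by (auto intro: Hom_P_step[OF f])
      ultimately show ?case unfolding e_Suc by (cases "b ! i") auto
    qed
    have "path s b i = f i" if "i \<le> n" for i
      using that
    proof (induction i)
      case (Suc i)
      then show ?case using fe[of i] path_step[OF len, of i s] by simp
    qed (simp add: path_0 f0)
    moreover have "path s b i = f i" if "\<not> i \<le> n" for i
      using that f by (auto simp: path_def P_verts_def Hom_P_def PiE_iff extensional_def)
    ultimately show ?thesis unfolding s_def b_def by blast
  qed
  have "bij_betw (\<lambda>(s, b). path s b) ?D (Hom_P n d)"
  proof (rule bij_betw_byWitness[where f' = code])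
    show "\<forall>a\<in>?D. code (case a of (s, b) \<Rightarrow> path s b) = a" using code_path by auto
    show "\<forall>f\<in>Hom_P n d. (case code f of (s, b) \<Rightarrow> path s b) = f"
      using path_code by (auto simp: case_prod_beta)
    show "(\<lambda>(s, b). path s b) ` ?D \<subseteq> Hom_P n d" using path_Hom by auto
    show "code ` Hom_P n d \<subseteq> ?D" using code_D by blast
  qed
  then show ?thesis by (simp add: path_def)
qed

section \<open>Sums over homomorphisms as sums over signed blocks\<close>

lemma sum_Hom_P:
  fixes \<phi> :: "int set \<Rightarrow> real"
  assumes n: "n > 0" and d: "d > 0"
  shows "(\<Sum>f\<in>Hom_P n d. \<phi> (Rng n f)) =
    (\<Sum>b\<leftarrow>alls d (n - 1). \<phi> (set (walk 0 1 (True # b))) + \<phi> (set (walk 0 (-1) (True # b))))"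
proof -
  have Rng: "Rng n (\<lambda>i\<in>P_verts n. walk 0 s (True # b) ! i) = set (walk 0 s (True # b))"
    if "length b = n - 1" for s b
  proof -
    have "length (walk 0 s (True # b)) = Suc n" using that n by simp
    then show ?thesis
      unfolding Rng_def P_verts_def by (force simp del: walk.simps simp: set_conv_nth less_Suc_eq_le)
  qed
  have "(\<Sum>f\<in>Hom_P n d. \<phi> (Rng n f)) =
      (\<Sum>(s, b)\<in>{1, -1} \<times> {b. length b = n - 1 \<and> valid d b}. \<phi> (set (walk 0 s (True # b))))"
    by (subst sum.reindex_bij_betw[OF bij_betw_Hom_P[OF n], symmetric])
       (auto intro!: sum.cong simp: Rng simp del: walk.simps)
  also have "\<dots> = (\<Sum>b\<in>set (alls d (n - 1)). \<phi> (set (walk 0 1 (True # b))) + \<phi> (set (walk 0 (-1) (True # b))))"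
    unfolding set_alls[OF d] sum.cartesian_product[symmetric] by (simp add: sum.distrib del: walk.simps)
  also have "\<dots> = (\<Sum>b\<leftarrow>alls d (n - 1). \<phi> (set (walk 0 1 (True # b))) + \<phi> (set (walk 0 (-1) (True # b))))"
    by (rule sum_list_distinct_conv_sum_set[OF distinct_alls[OF d], symmetric])
  finally show ?thesis .
qed

text \<open>The \<open>p\<close> bits before the first turn reverse the step \<open>p\<close> times,
  so the first step \<open>(-1) ^ p * \<sigma>\<close> gives the first phase the direction
  \<open>\<sigma>\<close>. Both first steps are summed over, so an odd \<open>p\<close> merely swaps
  them.\<close>

lemma sum_Hom_P_blks:
  fixes \<phi> :: "int set \<Rightarrow> real"
  assumes n: "n > 0" and d: "d > 0"
  shows "(\<Sum>f\<in>Hom_P n d. \<phi> (Rng n f)) =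
    \<phi> (set (walk 0 1 (True # replicate (n - 1) False))) +
    \<phi> (set (walk 0 (-1) (True # replicate (n - 1) False))) +
    (\<Sum>p<n - 1. \<Sum>Ls\<leftarrow>blks d (n - 2 - p). \<Sum>zs\<leftarrow>sgns Ls.
      \<phi> (set (walk 0 ((-1) ^ p * fst (hd zs)) (True # replicate p False @ True # enc d (n - 2 - p) zs))))"
proof -
  define g where "g s b = \<phi> (set (walk 0 s (True # b)))" for s b
  have "(\<Sum>b\<leftarrow>tails d L. g 1 (replicate p False @ True # b) + g (-1) (replicate p False @ True # b)) =
    (\<Sum>Ls\<leftarrow>blks d L. \<Sum>zs\<leftarrow>sgns Ls. g ((-1) ^ p * fst (hd zs)) (replicate p False @ True # enc d L zs))" for p L
    unfolding sum_tails_eq_sum_blks[of "\<lambda>\<sigma> b. g ((-1) ^ p * \<sigma>) (replicate p False @ True # b)", symmetric]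
    by (cases "even p") (simp_all add: add.commute)
  then show ?thesis
    unfolding sum_Hom_P[OF n d] g_def[symmetric] sum_alls[of "\<lambda>b. g 1 b + g (-1) b"]
    by (simp add: numeral_2_eq_2)
qed

section \<open>The walk of the centres\<close>

text \<open>The centre of a phase is the value taken at all vertices of one parity; it moves by the sign
  of the block at each transition. \<open>mabs\<close> is the running maximum of the modulus of the centre at
  the ends of blocks, and \<open>disp\<close> the total displacement of the centre.\<close>

fun mabs :: "int \<Rightarrow> int \<Rightarrow> (int \<times> nat) list \<Rightarrow> int" where
  "mabs z m [] = m"
| "mabs z m ((\<sigma>, l) # zs) = mabs (z + \<sigma> * int l) (max m \<bar>z + \<sigma> * int l\<bar>) zs"

fun disp :: "(int \<times> nat) list \<Rightarrow> int" where
  "disp [] = 0"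
| "disp ((\<sigma>, l) # zs) = \<sigma> * int l + disp zs"

lemma mabs_ge: "m \<le> mabs z m zs"
proof (induction zs arbitrary: z m)
  case (Cons p zs)
  show ?case
    using Cons[of "max m \<bar>z + fst p * int (snd p)\<bar>" "z + fst p * int (snd p)"] by (cases p) simp
qed simp

section \<open>Values visited by an encoded path\<close>

lemma walk_not_Nil [simp]: "walk x s b \<noteq> []"
  by (cases b) auto

lemma start_in_walk [simp]: "x \<in> set (walk x s b)"
  by (cases b) auto

text \<open>Without turns the path alternates between \<open>x\<close> and \<open>x - s\<close>.
  Both values are added on both sides because for \<open>p = 0\<close> the value
  \<open>x - s\<close> need not have been visited.\<close>

lemma walk_zigzag:
  fixes x s :: int
  defines "y \<equiv> \<lambda>p. if even p then x else x - s" and "\<sigma> \<equiv> \<lambda>p. if even p then s else - s"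
  shows "set (walk x s (replicate p False @ b)) \<union> {x, x - s} = {x, x - s} \<union> set (walk (y p) (\<sigma> p) b)"
    and "last (walk x s (replicate p False @ b)) = last (walk (y p) (\<sigma> p) b)"
  unfolding y_def \<sigma>_def
proof (induction p arbitrary: x s)
  case (Suc p)
  { case 1 show ?case using Suc(1)[of "x - s" "- s"] by (auto split: if_splits) }
  { case 2 show ?case using Suc(2)[of "x - s" "- s"] by (auto split: if_splits) }
qed auto

lemma walk_interval:
  assumes "s = 1 \<or> s = -1"
  shows "{min x (last (walk x s b))..max x (last (walk x s b))} \<subseteq> set (walk x s b)"
  using assms
proof (induction b arbitrary: x s)
  case (Cons c b)
  define s' where "s' = (if c then s else - s)"
  have s': "s' = 1 \<or> s' = -1" using Cons.prems by (auto simp: s'_def)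
  have w: "walk x s (c # b) = x # walk (x + s') s' b" by (simp add: s'_def)
  show ?case
  proof
    fix v assume v: "v \<in> {min x (last (walk x s (c # b)))..max x (last (walk x s (c # b)))}"
    show "v \<in> set (walk x s (c # b))"
    proof (cases "v = x")
      case False
      then have "v \<in> {min (x + s') (last (walk (x + s') s' b))..max (x + s') (last (walk (x + s') s' b))}"
        using v s' unfolding w by (auto simp: min_def max_def split: if_splits)
      then show ?thesis using Cons.IH[OF s', of "x + s'"] unfolding w by auto
    qed (simp add: w)
  qed
qed simp

text \<open>Here \<open>x\<close> is the current centre, \<open>c\<close> a reference centre and
  \<open>m\<close> a bound for the distance so far. A phase visits only its centre and the two
  neighbours, hence both errors of one. The ends of blocks suffice, since inside a block the centre
  moves monotonically.\<close>

lemma enc_bounds: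
  assumes "Ls \<in> set (blks d L)" "zs \<in> set (sgns Ls)" "\<bar>x - c\<bar> \<le> m" "\<sigma> = fst (hd zs)"
  shows "(\<forall>v\<in>set (walk (x + \<sigma>) \<sigma> (enc d L zs)). \<bar>v - c\<bar> \<le> mabs (x - c) m zs + 1) \<and>
    \<bar>last (walk (x + \<sigma>) \<sigma> (enc d L zs)) - (x + disp zs)\<bar> \<le> 1"
  using assms
proof (induction L arbitrary: Ls zs x m \<sigma> rule: less_induct)
  case (less L)
  obtain \<tau> l zs' where zs: "zs = (\<tau>, l) # zs'"
  proof (cases zs)
    case Nil
    then show ?thesis using map_snd_sgns[OF less.prems(2)] blks_nonempty[OF less.prems(1)] by simp
  qed auto
  have \<tau>: "\<tau> = 1 \<or> \<tau> = -1" using fst_sgns[OF less.prems(2), of "(\<tau>, l)"] zs by simp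
  have \<sigma>: "\<sigma> = \<tau>" using less.prems(4) zs by simp
  show ?case
  proof (cases "L < 2")
    case True
    then have "Ls = [0]" using less.prems(1) by (subst (asm) blks.simps) simp
    then have z: "l = 0" "zs' = []" using less.prems(2) zs by auto
    have e: "enc d L zs = replicate L False" using True by (subst enc.simps) simp
    have "set (walk (x + \<tau>) \<tau> (replicate L False @ [])) \<union> {x + \<tau>, x + \<tau> - \<tau>} \<subseteq> {x + \<tau>, x}"
      unfolding walk_zigzag(1)[of "x + \<tau>" \<tau> L "[]"] by auto
    then have "set (walk (x + \<tau>) \<tau> (enc d L zs)) \<subseteq> {x + \<tau>, x}"
      unfolding e by auto
    moreover from this have "last (walk (x + \<tau>) \<tau> (enc d L zs)) \<in> {x + \<tau>, x}"
      using last_in_set[OF walk_not_Nil] by blast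
    ultimately show ?thesis
      unfolding \<sigma> zs using z \<tau> less.prems(3) by auto
  next
    case False
    then consider Ls' where "Ls = 0 # Ls'" "Ls' \<in> set (blks d (L - 2))"
      | Ls' where "2 * d + 1 \<le> L" "Ls = inc Ls'" "Ls' \<in> set (blks d (L - (2 * d + 1)))"
      using less.prems(1) by (subst (asm) blks.simps) (auto split: if_splits)
    then show ?thesis
    proof cases
      case 1
      have l: "l = 0" and zs': "zs' \<in> set (sgns Ls')"
        using less.prems(2) 1(1) zs by auto
      obtain \<rho> l' zs'' where zs'': "zs' = (\<rho>, l') # zs''"
        using map_snd_sgns[OF zs'] blks_nonempty[OF 1(2)] by (cases zs') auto
      have \<rho>: "\<rho> = 1 \<or> \<rho> = -1" using fst_sgns[OF zs', of "(\<rho>, l')"] zs'' by simp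
      have e: "enc d L zs = False # (\<rho> \<noteq> \<tau>) # enc d (L - 2) zs'"
        using False by (subst enc.simps) (simp add: zs l zs'')
      have "(if \<rho> \<noteq> \<tau> then - \<tau> else - (- \<tau>)) = \<rho>" using \<tau> \<rho> by auto
      then have w: "walk (x + \<tau>) \<tau> (enc d L zs) = (x + \<tau>) # x # walk (x + \<rho>) \<rho> (enc d (L - 2) zs')"
        unfolding e by simp
      have IH: "(\<forall>v\<in>set (walk (x + \<rho>) \<rho> (enc d (L - 2) zs')). \<bar>v - c\<bar> \<le> mabs (x - c) m zs' + 1) \<and>
          \<bar>last (walk (x + \<rho>) \<rho> (enc d (L - 2) zs')) - (x + disp zs')\<bar> \<le> 1"
        using False by (intro less.IH[OF _ 1(2) zs' less.prems(3)]) (auto simp: zs'')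
      have m: "mabs (x - c) m zs = mabs (x - c) m zs'" "disp zs = disp zs'"
        using less.prems(3) by (simp_all add: zs l max_absorb1)
      have "\<bar>x + \<tau> - c\<bar> \<le> mabs (x - c) m zs' + 1" "\<bar>x - c\<bar> \<le> mabs (x - c) m zs' + 1"
        using \<tau> less.prems(3) mabs_ge[of m "x - c" zs'] by auto
      then show ?thesis
        unfolding \<sigma> w m using IH by simp
    next
      case 2
      obtain l' Ls'' where Ls': "Ls' = l' # Ls''" using blks_nonempty[OF 2(3)] by (cases Ls') auto
      have l: "l = Suc l'" and zs': "(\<tau>, l') # zs' \<in> set (sgns Ls')"
        using less.prems(2) unfolding 2(2) Ls' zs by auto
      have e: "enc d L zs = replicate (2 * d) False @ True # enc d (L - (2 * d + 1)) ((\<tau>, l') # zs')"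
        using False by (subst enc.simps) (simp add: zs l)
      define w where "w = walk (x + \<tau> + \<tau>) \<tau> (enc d (L - (2 * d + 1)) ((\<tau>, l') # zs'))"
      define M where "M = mabs (x + \<tau> - c) (max m \<bar>x + \<tau> - c\<bar>) ((\<tau>, l') # zs')"
      have IH: "(\<forall>v\<in>set w. \<bar>v - c\<bar> \<le> M + 1) \<and> \<bar>last w - (x + \<tau> + disp ((\<tau>, l') # zs'))\<bar> \<le> 1"
        unfolding w_def M_def using False by (intro less.IH[OF _ 2(3) zs']) auto
      have s: "set (walk (x + \<tau>) \<tau> (enc d L zs)) \<subseteq> {x + \<tau>, x} \<union> set w"
        using walk_zigzag(1)[of "x + \<tau>" \<tau> "2 * d" "True # enc d (L - (2 * d + 1)) ((\<tau>, l') # zs')"]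
        unfolding e w_def by auto
      have la: "last (walk (x + \<tau>) \<tau> (enc d L zs)) = last w"
        unfolding e w_def walk_zigzag(2) by simp
      \<comment> \<open>The intermediate centre \<open>x + \<tau>\<close> lies between
        \<open>x\<close> and the end of the block, so by convexity of the modulus it does not affect
        the maximum.\<close>
      have "max (max m \<bar>x + \<tau> - c\<bar>) \<bar>x + \<tau> - c + \<tau> * int l'\<bar> = max m \<bar>x - c + \<tau> * int (Suc l')\<bar>"
        using less.prems(3) \<tau> by (auto simp: max_def abs_if)
      then have M: "mabs (x - c) m zs = M"
        unfolding M_def zs l by (simp add: algebra_simps)
      have "m \<le> M" using mabs_ge[of m "x - c" zs] M by simp
      then have "\<bar>x + \<tau> - c\<bar> \<le> M + 1" "\<bar>x - c\<bar> \<le> M + 1"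
        using \<tau> less.prems(3) by auto
      moreover have "disp zs = \<tau> + disp ((\<tau>, l') # zs')" by (simp add: zs l algebra_simps)
      ultimately show ?thesis
        unfolding \<sigma> M la using s IH by auto
    qed
  qed
qed

text \<open>The witness \<open>y\<close> is the centre of the first phase, the middle value of the
  first turn; until then the path alternates between \<open>y - \<sigma>\<close> and
  \<open>y\<close>.\<close>

lemma walk_prefix:
  "\<exists>y. set (walk 0 ((-1) ^ p * \<sigma>) (True # replicate p False @ True # b)) =
     {y - \<sigma>, y} \<union> set (walk (y + \<sigma>) \<sigma> b)"
proof -
  define s where "s = (-1) ^ p * \<sigma>"
  define y where "y = (if even p then s else 0)"
  have "set (walk 0 s (True # replicate p False @ True # b)) =
      set (walk s s (replicate p False @ True # b)) \<union> {s, s - s}"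
    by (auto simp: insert_absorb)
  also have "\<dots> = {s, s - s} \<union> set (walk (if even p then s else s - s) (if even p then s else - s) (True # b))"
    by (rule walk_zigzag)
  also have "\<dots> = {y - \<sigma>, y} \<union> set (walk (y + \<sigma>) \<sigma> b)"
    by (auto simp: y_def s_def)
  finally show ?thesis unfolding s_def by blast
qed

text \<open>The first turn alone visits \<open>y - \<sigma>\<close>, \<open>y\<close> and
  \<open>y + \<sigma>\<close>. The last bound comes from the interval between
  \<open>y + \<sigma>\<close> and the final value, which is within one of
  \<open>y + disp zs\<close>: two unit errors, less the extra endpoint of the interval.\<close>

lemma card_phases:
  fixes p :: nat
  assumes "Ls \<in> set (blks d L)" "zs \<in> set (sgns Ls)"
  defines "S \<equiv> set (walk 0 ((-1) ^ p * fst (hd zs)) (True # replicate p False @ True # enc d L zs))"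
  shows "3 \<le> card S" and "int (card S) \<le> 2 * mabs 0 0 zs + 3" and "\<bar>disp zs\<bar> \<le> int (card S) + 1"
proof -
  define \<sigma> where "\<sigma> = fst (hd zs)"
  have "zs \<noteq> []" using map_snd_sgns[OF assms(2)] blks_nonempty[OF assms(1)] by auto
  then have \<sigma>: "\<sigma> = 1 \<or> \<sigma> = -1" using fst_sgns[OF assms(2), of "hd zs"] by (simp add: \<sigma>_def)
  obtain y where S: "S = {y - \<sigma>, y} \<union> set (walk (y + \<sigma>) \<sigma> (enc d L zs))"
    using walk_prefix[of p \<sigma> "enc d L zs"] unfolding S_def \<sigma>_def by blast
  have fin: "finite S" by (simp add: S_def)
  let ?w = "walk (y + \<sigma>) \<sigma> (enc d L zs)"
  have b: "\<forall>v\<in>set ?w. \<bar>v - y\<bar> \<le> mabs (y - y) 0 zs + 1" "\<bar>last ?w - (y + disp zs)\<bar> \<le> 1"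
    using enc_bounds[OF assms(1,2), of y y 0 \<sigma>] by (simp_all add: \<sigma>_def)
  have "{y - \<sigma>, y, y + \<sigma>} \<subseteq> S" unfolding S using start_in_walk[of "y + \<sigma>"] by blast
  moreover have "card {y - \<sigma>, y, y + \<sigma>} = 3" using \<sigma> by auto
  ultimately show "3 \<le> card S" using card_mono[OF fin] by metis
  have "S \<subseteq> {y - mabs 0 0 zs - 1..y + mabs 0 0 zs + 1}"
  proof
    fix v assume "v \<in> S"
    then have "\<bar>v - y\<bar> \<le> mabs 0 0 zs + 1"
      using b(1) \<sigma> mabs_ge[of 0 0 zs] unfolding S by auto
    then show "v \<in> {y - mabs 0 0 zs - 1..y + mabs 0 0 zs + 1}" by auto
  qed
  then have "card S \<le> card {y - mabs 0 0 zs - 1..y + mabs 0 0 zs + 1}" by (intro card_mono) auto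
  then show "int (card S) \<le> 2 * mabs 0 0 zs + 3" using mabs_ge[of 0 0 zs] by simp
  have "{min (y + \<sigma>) (last ?w)..max (y + \<sigma>) (last ?w)} \<subseteq> S"
    using walk_interval[OF \<sigma>] unfolding S by blast
  then have "card {min (y + \<sigma>) (last ?w)..max (y + \<sigma>) (last ?w)} \<le> card S"
    by (intro card_mono fin)
  then have "\<bar>last ?w - (y + \<sigma>)\<bar> + 1 \<le> int (card S)" by (simp add: min_def max_def abs_if split: if_splits)
  then show "\<bar>disp zs\<bar> \<le> int (card S) + 1" using b(2) \<sigma> by auto
qed

lemma card_walk_alternating: "card (set (walk 0 s (True # replicate N False))) \<le> 2"
proof -
  have "set (walk 0 s (True # replicate N False @ [])) \<subseteq> {0, s}"
    using walk_zigzag(1)[of s s N "[]"] by (auto split: if_splits)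
  then have "card (set (walk 0 s (True # replicate N False))) \<le> card {0, s}"
    by (intro card_mono) auto
  also have "\<dots> \<le> 2" by (simp add: card_insert_if)
  finally show ?thesis .
qed

section \<open>Counting block sequences\<close>

lemma length_inc [simp]: "length (inc Ls) = length Ls"
  by (cases Ls) auto

lemma length_sgns [simp]: "length (sgns Ls) = 2 ^ length Ls"
  by (induction Ls) auto

text \<open>Twice the number of tails of length \<open>L\<close>, the factor two being the sign of the first block.\<close>

definition R :: "nat \<Rightarrow> nat \<Rightarrow> real" where
  "R d L = (\<Sum>Ls\<leftarrow>blks d L. 2 ^ length Ls)"

lemma R_rec:
  "R d L = (if L < 2 then 2 else 2 * R d (L - 2) + (if 2 * d + 1 \<le> L then R d (L - (2 * d + 1)) else 0))"
  unfolding R_def by (subst sum_list_blks) (simp add: sum_list_const_mult)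

lemma R_pos: "0 < R d L"
proof (induction L rule: less_induct)
  case (less L)
  then show ?case
    by (subst R_rec) (auto intro: add_pos_pos)
qed

lemma R_nonneg [simp]: "0 \<le> R d L"
  using R_pos[of d L] by simp

section \<open>Growth of the number of continuations\<close>

lemma R_ge_double: "2 * R d L \<le> R d (L + 2)"
  by (subst (2) R_rec) simp

lemma R_mono_Suc: "R d L \<le> R d (Suc L)"
proof (induction L rule: less_induct)
  case (less L)
  consider "L = 0" | "L = 1" | "2 \<le> L" by linarith
  then show ?case
  proof cases
    case 1
    then show ?thesis by (simp add: R_rec)
  next
    case 2
    have "R d 0 = 2" "R d 1 = 2" by (simp_all add: R_rec)
    then show ?thesis using R_ge_double[of d 0] 2 by (simp add: numeral_2_eq_2)
  next
    case 3
    then have e: "Suc (L - 2) = Suc L - 2" and "L - 2 < L" by simp_all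
    from less.IH[OF this(2)] have "R d (L - 2) \<le> R d (Suc L - 2)" unfolding e .
    moreover have "R d (L - (2 * d + 1)) \<le> R d (Suc L - (2 * d + 1))" if "2 * d + 1 \<le> L"
    proof -
      have e: "Suc (L - (2 * d + 1)) = Suc L - (2 * d + 1)" and "L - (2 * d + 1) < L"
        using that by simp_all
      from less.IH[OF this(2)] show ?thesis unfolding e .
    qed
    ultimately show ?thesis
      using 3 by (subst (1 2) R_rec) (auto intro: add_mono add_increasing2)
  qed
qed

lemma R_mono: "L \<le> L' \<Longrightarrow> R d L \<le> R d L'"
  by (rule lift_Suc_mono_le[of "R d", OF R_mono_Suc])

lemma R_ge_pow: "2 ^ j * R d L \<le> R d (L + 2 * j)"
proof (induction j)
  case (Suc j)
  have "2 ^ Suc j * R d L \<le> 2 * R d (L + 2 * j)" using Suc by simp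
  also have "\<dots> \<le> R d (L + 2 * Suc j)" using R_ge_double[of d "L + 2 * j"] by simp
  finally show ?case .
qed simp

text \<open>The transition term of the recursion sits \<open>2 * d - 1\<close> places below
  \<open>L\<close>, so doubling \<open>d - 1\<close> times bounds it by
  \<open>2 / 2 ^ d * R d L\<close>.\<close>

lemma R_le_double:
  assumes d: "d > 0"
  shows "R d (L + 2) \<le> 2 * (1 + 1 / 2 ^ d) * R d L"
proof (cases "2 * d + 1 \<le> L + 2")
  case True
  define z where "z = L + 2 - (2 * d + 1)"
  have "2 ^ (d - 1) * R d z \<le> R d (z + 2 * (d - 1))" by (rule R_ge_pow)
  also have "\<dots> \<le> R d L" using True d by (intro R_mono) (simp add: z_def)
  finally have "2 ^ d * R d z \<le> 2 * R d L" using d by (cases d) auto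
  then have "R d z \<le> 2 * (1 / 2 ^ d) * R d L" by (simp add: field_simps)
  moreover have "R d (L + 2) = 2 * R d L + R d z"
    using True by (subst R_rec) (simp add: z_def)
  ultimately show ?thesis by (simp add: algebra_simps)
next
  case False
  then have "R d (L + 2) = 2 * R d L" by (subst R_rec) simp
  then show ?thesis by (simp add: algebra_simps)
qed

lemma two_mult_le_pow: "d > 0 \<Longrightarrow> 2 * d \<le> 2 ^ d"
proof (induction d)
  case (Suc d)
  then show ?case by (cases d) auto
qed simp

lemma R_le_shift:
  assumes d: "d > 0"
  shows "R d (z + 2 * d) \<le> 2 * 2 ^ d * R d z"
proof -
  have "R d (z + 2 * j) \<le> (2 * (1 + 1 / 2 ^ d)) ^ j * R d z" for j
  proof (induction j)
    case (Suc j)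
    have "R d (z + 2 * Suc j) \<le> 2 * (1 + 1 / 2 ^ d) * R d (z + 2 * j)"
      using R_le_double[OF d, of "z + 2 * j"] by simp
    also have "\<dots> \<le> 2 * (1 + 1 / 2 ^ d) * ((2 * (1 + 1 / 2 ^ d)) ^ j * R d z)"
      by (intro mult_left_mono Suc.IH) auto
    finally show ?case by simp
  qed simp
  note this[of d]
  \<comment> \<open>The excess over pure doubling accumulates to at most
    \<open>exp (d / 2 ^ d)\<close>, and \<open>2 * d \<le> 2 ^ d\<close>.\<close>
  also have "(2 * (1 + 1 / 2 ^ d)) ^ d \<le> 2 * (2::real) ^ d"
  proof -
    have "real (2 * d) \<le> real (2 ^ d)" using two_mult_le_pow[OF d] by (intro of_nat_mono)
    then have e: "real d * (1 / 2 ^ d) \<le> 1 / 2" by (simp add: field_simps)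
    have "(1 + 1 / 2 ^ d) ^ d \<le> exp (1 / 2 ^ d :: real) ^ d"
      by (intro power_mono exp_ge_add_one_self) auto
    also have "\<dots> = exp (real d * (1 / 2 ^ d))" by (rule exp_of_nat_mult[symmetric])
    also have "\<dots> \<le> exp (1 / 2)" using e by simp
    also have "\<dots> \<le> 2" by (rule exp_half_le2)
    finally have "2 ^ d * (1 + 1 / 2 ^ d) ^ d \<le> 2 ^ d * (2::real)"
      by (intro mult_left_mono) auto
    then show ?thesis unfolding power_mult_distrib by simp
  qed
  finally show ?thesis by (simp add: mult_right_mono)
qed

section \<open>Second moment of the block lengths\<close>

definition sqsum :: "nat list \<Rightarrow> real" where
  "sqsum Ls = (\<Sum>l\<leftarrow>Ls. (real l)\<^sup>2)"

text \<open>The factor is the increase of the square when the head block grows by one. Its mean is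
  at most 2 because a pair resets the head to 0 and \<open>R d z \<le> R d (L - 2)\<close> keeps
  transitions from dominating.\<close>

lemma sum_head_le:
  assumes d: "d > 0"
  shows "(\<Sum>Ls\<leftarrow>blks d L. 2 ^ length Ls * (2 * real (hd Ls) + 1)) \<le> 2 * R d L"
proof (induction L rule: less_induct)
  case (less L)
  show ?case
  proof (cases "L < 2")
    case True
    then show ?thesis by (simp add: sum_list_blks R_rec)
  next
    case L: False
    have 1: "(\<Sum>Ls\<leftarrow>blks d (L - 2). 2 ^ length (0 # Ls) * (2 * real (hd (0 # Ls)) + 1)) = 2 * R d (L - 2)"
      by (simp add: R_def sum_list_const_mult)
    show ?thesis
    proof (cases "2 * d + 1 \<le> L")
      case True
      define z where "z = L - (2 * d + 1)"
      have "(\<Sum>Ls\<leftarrow>blks d z. 2 ^ length (inc Ls) * (2 * real (hd (inc Ls)) + 1)) =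
          (\<Sum>Ls\<leftarrow>blks d z. 2 ^ length Ls * (2 * real (hd Ls) + 1) + 2 * 2 ^ length Ls)"
      proof (rule sum_list_cong)
        fix Ls assume "Ls \<in> set (blks d z)"
        then have "Ls \<noteq> []" by (rule blks_nonempty)
        then show "2 ^ length (inc Ls) * (2 * real (hd (inc Ls)) + 1) =
            2 ^ length Ls * (2 * real (hd Ls) + 1) + 2 * (2::real) ^ length Ls"
          by (cases Ls) (auto simp: algebra_simps)
      qed
      also have "\<dots> = (\<Sum>Ls\<leftarrow>blks d z. 2 ^ length Ls * (2 * real (hd Ls) + 1)) + 2 * R d z"
        by (simp only: R_def sum_list_const_mult sum_list_addf)
      also have "\<dots> \<le> 2 * R d z + 2 * R d z"
        using less.IH[of z] True L by (simp add: z_def)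
      finally have 2: "(\<Sum>Ls\<leftarrow>blks d z. 2 ^ length (inc Ls) * (2 * real (hd (inc Ls)) + 1)) \<le> 4 * R d z"
        by simp
      have "R d z \<le> R d (L - 2)" using d by (intro R_mono) (simp add: z_def)
      moreover have "R d L = 2 * R d (L - 2) + R d z" using L True by (subst R_rec) (simp add: z_def)
      ultimately show ?thesis
        using 2 L True unfolding sum_list_blks[of _ _ L] 1 z_def by simp
    next
      case False
      then have "R d L = 2 * R d (L - 2)" using L by (subst R_rec) simp
      then show ?thesis using L False unfolding sum_list_blks[of _ _ L] 1 by simp
    qed
  qed
qed

text \<open>A pair uses two places and adds no square, which leaves a surplus
  \<open>4 / 2 ^ d * R d (L - 2)\<close>. This pays for the increase \<open>2 * R d z\<close> due to
  a transition with \<open>z\<close> places left.\<close>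

lemma sum_sqsum_le:
  assumes d: "d > 0"
  shows "(\<Sum>Ls\<leftarrow>blks d L. 2 ^ length Ls * sqsum Ls) \<le> real L / 2 ^ d * R d L"
proof (induction L rule: less_induct)
  case (less L)
  show ?case
  proof (cases "L < 2")
    case True
    then show ?thesis by (simp add: sum_list_blks sqsum_def)
  next
    case L: False
    have "(\<Sum>Ls\<leftarrow>blks d (L - 2). 2 ^ length (0 # Ls) * sqsum (0 # Ls)) =
        2 * (\<Sum>Ls\<leftarrow>blks d (L - 2). 2 ^ length Ls * sqsum Ls)"
      by (simp add: sqsum_def sum_list_const_mult[symmetric] mult.assoc)
    also have "\<dots> \<le> 2 * (real (L - 2) / 2 ^ d * R d (L - 2))"
      using less.IH[of "L - 2"] L by simp
    also have "real (L - 2) = real L - 2" using L by simp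
    finally have 1: "(\<Sum>Ls\<leftarrow>blks d (L - 2). 2 ^ length (0 # Ls) * sqsum (0 # Ls)) \<le>
        2 * ((real L - 2) / 2 ^ d * R d (L - 2))" .
    show ?thesis
    proof (cases "2 * d + 1 \<le> L")
      case True
      define z where "z = L - (2 * d + 1)"
      have z: "real z \<le> real L" by (simp add: z_def)
      have "(\<Sum>Ls\<leftarrow>blks d z. 2 ^ length (inc Ls) * sqsum (inc Ls)) =
          (\<Sum>Ls\<leftarrow>blks d z. 2 ^ length Ls * sqsum Ls + 2 ^ length Ls * (2 * real (hd Ls) + 1))"
      proof (rule sum_list_cong)
        fix Ls assume "Ls \<in> set (blks d z)"
        then have "Ls \<noteq> []" by (rule blks_nonempty)
        then show "2 ^ length (inc Ls) * sqsum (inc Ls) =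
            2 ^ length Ls * sqsum Ls + 2 ^ length Ls * (2 * real (hd Ls) + 1)"
          by (cases Ls) (auto simp: sqsum_def algebra_simps power2_eq_square)
      qed
      also have "\<dots> = (\<Sum>Ls\<leftarrow>blks d z. 2 ^ length Ls * sqsum Ls) +
          (\<Sum>Ls\<leftarrow>blks d z. 2 ^ length Ls * (2 * real (hd Ls) + 1))"
        by (rule sum_list_addf)
      also have "\<dots> \<le> real z / 2 ^ d * R d z + 2 * R d z"
        using less.IH[of z] True L by (intro add_mono sum_head_le[OF d]) (simp add: z_def)
      also have "\<dots> \<le> real L / 2 ^ d * R d z + 2 * R d z"
        using z by (intro add_right_mono mult_right_mono divide_right_mono) auto
      finally have 2: "(\<Sum>Ls\<leftarrow>blks d z. 2 ^ length (inc Ls) * sqsum (inc Ls)) \<le>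
          real L / 2 ^ d * R d z + 2 * R d z" .
      have "2 ^ (d - 1) * R d z \<le> R d (z + 2 * (d - 1))" by (rule R_ge_pow)
      also have "\<dots> \<le> R d (L - 2)" using True d by (intro R_mono) (simp add: z_def)
      finally have "2 ^ d * R d z \<le> 2 * R d (L - 2)" using d by (cases d) auto
      then have b: "2 * R d z \<le> 4 / 2 ^ d * R d (L - 2)" by (simp add: field_simps)
      have r: "R d L = 2 * R d (L - 2) + R d z" using L True by (subst R_rec) (simp add: z_def)
      have "(\<Sum>Ls\<leftarrow>blks d L. 2 ^ length Ls * sqsum Ls) \<le>
          2 * ((real L - 2) / 2 ^ d * R d (L - 2)) + (real L / 2 ^ d * R d z + 4 / 2 ^ d * R d (L - 2))"
        using 1 2 b L True unfolding sum_list_blks[of _ _ L] z_def by simp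
      also have "\<dots> = real L / 2 ^ d * R d L" unfolding r by (simp add: field_simps)
      finally show ?thesis .
    next
      case False
      then have r: "R d L = 2 * R d (L - 2)" using L by (subst R_rec) simp
      have "2 * ((real L - 2) / 2 ^ d * R d (L - 2)) \<le> real L / 2 ^ d * R d L"
        unfolding r by (simp add: field_simps)
      then show ?thesis using 1 L False unfolding sum_list_blks[of _ _ L] by simp
    qed
  qed
qed

text \<open>A generating function for the number of blocks of length one, where the first block already
  has \<open>j\<close> further transitions.\<close>

definition Q :: "nat \<Rightarrow> nat \<Rightarrow> nat \<Rightarrow> real" where
  "Q d j L = (\<Sum>Ls\<leftarrow>blks d L. 2 ^ length Ls * (1 / 4) ^ count_list ((hd Ls + j) # tl Ls) 1)"

text \<open>A pair closes the head block at exactly \<open>j\<close> transitions, so the weight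
  \<open>1 / 4\<close> appears only for \<open>j = 1\<close>; a transition passes from state
  \<open>j\<close> to \<open>Suc j\<close>.\<close>

lemma Q_rec:
  "Q d j L = (if L < 2 then 2 * (if j = 1 then 1 / 4 else 1) else
     2 * (if j = 1 then 1 / 4 else 1) * Q d 0 (L - 2) +
     (if 2 * d + 1 \<le> L then Q d (Suc j) (L - (2 * d + 1)) else 0))"
proof -
  have 1: "(\<Sum>Ls\<leftarrow>blks d l. 2 ^ length (0 # Ls) * (1 / 4) ^ count_list ((hd (0 # Ls) + j) # tl (0 # Ls)) 1) =
      2 * (if j = 1 then 1 / 4 else 1) * Q d 0 l" for l
    unfolding Q_def sum_list_const_mult[symmetric]
  proof (rule sum_list_cong)
    fix Ls assume "Ls \<in> set (blks d l)"
    then have "Ls \<noteq> []" by (rule blks_nonempty)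
    then show "2 ^ length (0 # Ls) * (1 / 4) ^ count_list ((hd (0 # Ls) + j) # tl (0 # Ls)) 1 =
        2 * (if j = 1 then 1 / 4 else 1) * (2 ^ length Ls * (1 / 4 :: real) ^ count_list ((hd Ls + 0) # tl Ls) 1)"
      by (cases Ls) auto
  qed
  have 2: "(\<Sum>Ls\<leftarrow>blks d l. 2 ^ length (inc Ls) * (1 / 4) ^ count_list ((hd (inc Ls) + j) # tl (inc Ls)) 1) =
      Q d (Suc j) l" for l
    unfolding Q_def
  proof (rule sum_list_cong)
    fix Ls assume "Ls \<in> set (blks d l)"
    then have "Ls \<noteq> []" by (rule blks_nonempty)
    then show "2 ^ length (inc Ls) * (1 / 4) ^ count_list ((hd (inc Ls) + j) # tl (inc Ls)) 1 =
        2 ^ length Ls * (1 / 4 :: real) ^ count_list ((hd Ls + Suc j) # tl Ls) 1"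
      by (cases Ls) auto
  qed
  show ?thesis
  proof (cases "L < 2")
    case False
    then show ?thesis
      unfolding Q_def[of d j L] sum_list_blks[of _ d L] 1 2 by simp
  qed (simp add: Q_def sum_list_blks)
qed

lemma Q_le_R: "Q d j L \<le> R d L"
  unfolding Q_def R_def
  by (intro sum_list_mono) (simp add: power_le_one mult_left_le)

lemma Q_nonneg: "0 \<le> Q d j L"
  unfolding Q_def by (intro sum_list_nonneg) auto

text \<open>The per-step rate of the exponential decay of \<open>Q d 0 L / R d L\<close>.\<close>

definition \<nu> :: "nat \<Rightarrow> real" where
  "\<nu> d = 1 + 1 / (100 * 2 ^ d)"

lemma \<nu>_ge_1: "1 \<le> \<nu> d"
  by (simp add: \<nu>_def)

lemma \<nu>_pow_le:
  assumes d: "d > 0"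
  shows "\<nu> d ^ (2 * d + 1) \<le> 11 / 10"
proof -
  have "real (2 * d) \<le> real (2 ^ d)" using two_mult_le_pow[OF d] by (intro of_nat_mono)
  then have "2 * real d \<le> 2 ^ d" by simp
  moreover have "(1::real) \<le> 2 ^ d" by simp
  ultimately have "2 * real d + 1 \<le> 2 * 2 ^ d" by linarith
  then have e: "real (2 * d + 1) * (1 / (100 * 2 ^ d)) \<le> 2 / 100" by (simp add: field_simps)
  have "\<nu> d ^ (2 * d + 1) \<le> exp (1 / (100 * 2 ^ d)) ^ (2 * d + 1)"
    unfolding \<nu>_def by (intro power_mono exp_ge_add_one_self) auto
  also have "\<dots> = exp (real (2 * d + 1) * (1 / (100 * 2 ^ d)))" by (rule exp_of_nat_mult[symmetric])
  also have "\<dots> \<le> exp (2 / 100)" using e by simp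
  also have "\<dots> \<le> 1 + 2 / 100 + (2 / 100)\<^sup>2" by (rule exp_bound) auto
  also have "\<dots> \<le> 11 / 10" by (simp add: power2_eq_square)
  finally show ?thesis .
qed

text \<open>The three constants depend on how many transitions the current block already has:
  in state 1 it is about to count, in states above 1 it no longer can.\<close>

lemma Q_le:
  assumes d: "d > 0"
  shows "\<nu> d ^ L * Q d j L \<le> (if j = 0 then 2 else if j = 1 then 3 / 2 else 12 / 5) * R d L"
proof (induction L arbitrary: j rule: less_induct)
  case (less L)
  show ?case
  proof (cases "2 * d + 1 \<le> L")
    case False
    have "\<nu> d ^ L \<le> \<nu> d ^ (2 * d + 1)" using False \<nu>_ge_1 by (intro power_increasing) auto
    then have "\<nu> d ^ L \<le> 11 / 10" using \<nu>_pow_le[OF d] by simp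
    then have "\<nu> d ^ L * Q d j L \<le> 11 / 10 * R d L"
      using Q_le_R[of d j L] Q_nonneg by (intro mult_mono) auto
    also have "\<dots> \<le> (if j = 0 then 2 else if j = 1 then 3 / 2 else 12 / 5) * R d L"
      by (intro mult_right_mono) auto
    finally show ?thesis .
  next
    case True
    define z where "z = L - (2 * d + 1)"
    define a b where "a = R d (L - 2)" and "b = R d z"
    define q0 where "q0 = \<nu> d ^ (L - 2) * Q d 0 (L - 2)"
    define q' where "q' = \<nu> d ^ z * Q d (Suc j) z"
    define K where "K = (if j = 0 then 3 / 2 else 12 / 5 :: real)"
    have L: "\<not> L < 2" "z < L" "L - 2 < L" using True d by (auto simp: z_def)
    have q0: "q0 \<le> 2 * a" using less.IH[OF L(3), of 0] by (simp add: q0_def a_def)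
    have q': "q' \<le> K * b" using less.IH[OF L(2), of "Suc j"] by (simp add: q'_def b_def K_def)
    have pos: "0 \<le> q0" "0 \<le> q'" "0 \<le> a" "0 \<le> b"
      using \<nu>_ge_1[of d] Q_nonneg by (auto simp: q0_def q'_def a_def b_def)
    have ba: "b \<le> a" unfolding a_def b_def using d by (intro R_mono) (simp add: z_def)
    have "L - 2 \<le> z + 2 * d" using True by (simp add: z_def)
    then have ab: "a \<le> 2 * 2 ^ d * b"
      unfolding a_def b_def using R_mono[of "L - 2" "z + 2 * d" d] R_le_shift[OF d, of z] by linarith
    have r: "R d L = 2 * a + b" using L True by (subst R_rec) (simp add: z_def a_def b_def)
    have N: "\<nu> d ^ 2 \<le> 1 + 3 / 100 / 2 ^ d"
    proof -
      have "(1 / (100 * 2 ^ d))\<^sup>2 \<le> 1 / (100 * 2 ^ d :: real)"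
      proof -
        have "(1::real) \<le> 2 ^ d" by simp
        then have "(1::real) \<le> 100 * 2 ^ d" by linarith
        then show ?thesis unfolding power2_eq_square by (intro mult_left_le_one_le) auto
      qed
      then show ?thesis by (simp add: \<nu>_def power2_eq_square algebra_simps)
    qed
    \<comment> \<open>The loss over two places is of order \<open>1 / 2 ^ d\<close> relative to
      \<open>a\<close>; the bound \<open>a \<le> 2 * 2 ^ d * b\<close> converts it into a small
      multiple of \<open>b\<close>.\<close>
    then have N1: "(\<nu> d ^ 2 - 1) * a \<le> 6 / 100 * b"
    proof -
      have "(\<nu> d ^ 2 - 1) * a \<le> 3 / 100 / 2 ^ d * (2 * 2 ^ d * b)"
        using N ab pos \<nu>_ge_1[of d] by (intro mult_mono) auto
      then show ?thesis by simp
    qed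
    have N2: "\<nu> d ^ 2 * q0 \<le> 2 * a + 12 / 100 * b"
    proof -
      have "\<nu> d ^ 2 * q0 \<le> \<nu> d ^ 2 * (2 * a)" using q0 by (intro mult_left_mono) auto
      also have "\<dots> = 2 * a + 2 * ((\<nu> d ^ 2 - 1) * a)" by (simp add: algebra_simps)
      finally show ?thesis using N1 by linarith
    qed
    have E: "\<nu> d ^ (2 * d + 1) * q' \<le> 11 / 10 * (K * b)"
      using \<nu>_pow_le[OF d] q' pos by (intro mult_mono) auto
    have "\<nu> d ^ L = \<nu> d ^ 2 * \<nu> d ^ (L - 2)"
      unfolding power_add[symmetric] using L by (simp only: le_add_diff_inverse not_less)
    then have s0: "\<nu> d ^ L * Q d 0 (L - 2) = \<nu> d ^ 2 * q0"
      unfolding q0_def by (simp only: mult.assoc)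
    have "\<nu> d ^ L = \<nu> d ^ (2 * d + 1) * \<nu> d ^ z"
      unfolding power_add[symmetric] z_def using True by (simp only: le_add_diff_inverse)
    then have s': "\<nu> d ^ L * Q d (Suc j) z = \<nu> d ^ (2 * d + 1) * q'"
      unfolding q'_def by (simp only: mult.assoc)
    have "Q d j L = 2 * (if j = 1 then 1 / 4 else 1) * Q d 0 (L - 2) + Q d (Suc j) z"
      using L True by (subst Q_rec) (simp add: z_def)
    moreover define u v where "u = \<nu> d ^ 2 * q0" and "v = \<nu> d ^ (2 * d + 1) * q'"
    ultimately have "\<nu> d ^ L * Q d j L = 2 * (if j = 1 then 1 / 4 else 1) * u + v"
      unfolding u_def v_def s0[symmetric] s'[symmetric] by (simp add: algebra_simps)
    \<comment> \<open>For \<open>j = 0\<close>, \<open>j = 1\<close> and \<open>j > 1\<close> the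
      claim becomes \<open>4 a + 1.89 b \<le> 4 a + 2 b\<close>,
      \<open>a + 2.7 b \<le> 3 a + 1.5 b\<close> and
      \<open>4 a + 2.88 b \<le> 4.8 a + 2.4 b\<close>; the last two follow from
      \<open>b \<le> a\<close>.\<close>
    then show ?thesis
      unfolding r using N2[folded u_def] E[folded v_def] ba pos by (auto simp: K_def)
  qed
qed

text \<open>Exponential Markov inequality: on the event, \<open>4 ^ M\<close> times the weight in
  \<open>Q d 0 L\<close> is at least one.\<close>

lemma few_ones:
  assumes d: "d > 0"
  shows "(\<Sum>Ls\<leftarrow>blks d L. 2 ^ length Ls * of_bool (count_list Ls 1 < M) :: real) \<le> 2 * 4 ^ M / \<nu> d ^ L * R d L"
proof -
  have "(\<Sum>Ls\<leftarrow>blks d L. 2 ^ length Ls * of_bool (count_list Ls 1 < M) :: real) \<le>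
      (\<Sum>Ls\<leftarrow>blks d L. 4 ^ M * (2 ^ length Ls * (1 / 4) ^ count_list ((hd Ls + 0) # tl Ls) 1))"
  proof (rule sum_list_mono)
    fix Ls assume "Ls \<in> set (blks d L)"
    then have "Ls \<noteq> []" by (rule blks_nonempty)
    then have h: "(hd Ls + 0) # tl Ls = Ls" by simp
    have "of_bool (count_list Ls 1 < M) \<le> 4 ^ M * (1 / 4 :: real) ^ count_list Ls 1"
    proof (cases "count_list Ls 1 < M")
      case True
      then have "(4::real) ^ count_list Ls 1 \<le> 4 ^ M" by (intro power_increasing) auto
      then show ?thesis using True by (simp add: power_divide field_simps)
    qed simp
    then have "2 ^ length Ls * of_bool (count_list Ls 1 < M) \<le>
        2 ^ length Ls * (4 ^ M * (1 / 4 :: real) ^ count_list Ls 1)"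
      by (intro mult_left_mono) auto
    then show "2 ^ length Ls * of_bool (count_list Ls 1 < M) \<le>
        4 ^ M * (2 ^ length Ls * (1 / 4 :: real) ^ count_list ((hd Ls + 0) # tl Ls) 1)"
      unfolding h by (simp add: mult.left_commute)
  qed
  also have "\<dots> = 4 ^ M * Q d 0 L" by (simp only: Q_def sum_list_const_mult)
  also have "Q d 0 L \<le> 2 * R d L / \<nu> d ^ L"
    using Q_le[OF d, of L 0] \<nu>_ge_1[of d] by (simp add: field_simps)
  finally show ?thesis by (simp add: field_simps)
qed

section \<open>Maximal inequality and anticoncentration\<close>

lemma sum_disp_squared:
  "(\<Sum>zs\<leftarrow>sgns Ls. (real_of_int (z + disp zs))\<^sup>2) = 2 ^ length Ls * ((real_of_int z)\<^sup>2 + sqsum Ls)"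
proof (induction Ls arbitrary: z)
  case (Cons l Ls)
  have "(\<Sum>zs\<leftarrow>sgns (l # Ls). (real_of_int (z + disp zs))\<^sup>2) =
      (\<Sum>zs\<leftarrow>sgns Ls. (real_of_int (z + int l + disp zs))\<^sup>2) +
      (\<Sum>zs\<leftarrow>sgns Ls. (real_of_int (z - int l + disp zs))\<^sup>2)"
    unfolding sum_list_sgns_Cons sum_list_addf[symmetric] by (simp add: algebra_simps)
  also have "\<dots> = 2 ^ length Ls * ((real_of_int (z + int l))\<^sup>2 + sqsum Ls) +
      2 ^ length Ls * ((real_of_int (z - int l))\<^sup>2 + sqsum Ls)"
    unfolding Cons.IH ..
  also have "\<dots> = 2 ^ length (l # Ls) * ((real_of_int z)\<^sup>2 + sqsum (l # Ls))"
    by (simp add: sqsum_def power2_eq_square algebra_simps)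
  finally show ?case .
qed (simp add: sqsum_def)

text \<open>The potential \<open>2 m \<bar>z\<bar> - m\<^sup>2\<close> does not decrease when \<open>m\<close> is replaced by
  \<open>max m \<bar>z\<bar>\<close>, and it is convex in \<open>z\<close>.\<close>

lemma mabs_submartingale:
  assumes "\<bar>z\<bar> \<le> m"
  shows "2 ^ length Ls * real_of_int (2 * m * \<bar>z\<bar> - m\<^sup>2) \<le>
    (\<Sum>zs\<leftarrow>sgns Ls. real_of_int (2 * mabs z m zs * \<bar>z + disp zs\<bar> - (mabs z m zs)\<^sup>2))"
  using assms
proof (induction Ls arbitrary: z m)
  case (Cons l Ls)
  define W where "W y = real_of_int (2 * max m \<bar>y\<bar> * \<bar>y\<bar> - (max m \<bar>y\<bar>)\<^sup>2)" for y
  have W: "real_of_int (2 * m * \<bar>y\<bar> - m\<^sup>2) \<le> W y" for y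
  proof (cases "\<bar>y\<bar> \<le> m")
    case False
    have "0 \<le> (m - \<bar>y\<bar>)\<^sup>2" by simp
    then have "2 * m * \<bar>y\<bar> - m\<^sup>2 \<le> \<bar>y\<bar>\<^sup>2"
      unfolding power2_diff by linarith
    moreover have "2 * max m \<bar>y\<bar> * \<bar>y\<bar> - (max m \<bar>y\<bar>)\<^sup>2 = \<bar>y\<bar>\<^sup>2"
      using False by (simp add: max_def power2_eq_square)
    ultimately show ?thesis unfolding W_def of_int_le_iff by linarith
  qed (simp add: W_def max_def)
  have "m \<ge> 0" using Cons.prems by linarith
  then have "m * (2 * \<bar>z\<bar>) \<le> m * (\<bar>z + int l\<bar> + \<bar>z - int l\<bar>)"
    by (intro mult_left_mono) auto
  then have "2 * (2 * m * \<bar>z\<bar> - m\<^sup>2) \<le> (2 * m * \<bar>z + int l\<bar> - m\<^sup>2) + (2 * m * \<bar>z - int l\<bar> - m\<^sup>2)"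
    by (simp add: algebra_simps)
  then have "real_of_int (2 * (2 * m * \<bar>z\<bar> - m\<^sup>2)) \<le>
      real_of_int ((2 * m * \<bar>z + int l\<bar> - m\<^sup>2) + (2 * m * \<bar>z - int l\<bar> - m\<^sup>2))"
    by (simp only: of_int_le_iff)
  then have "2 * real_of_int (2 * m * \<bar>z\<bar> - m\<^sup>2) \<le> W (z + int l) + W (z - int l)"
    using W[of "z + int l"] W[of "z - int l"] by (simp only: of_int_add of_int_mult of_int_numeral)
  then have "2 ^ length Ls * (2 * real_of_int (2 * m * \<bar>z\<bar> - m\<^sup>2)) \<le>
      2 ^ length Ls * (W (z + int l) + W (z - int l))"
    by (intro mult_left_mono) auto
  also have "\<dots> = 2 ^ length Ls * W (z + int l) + 2 ^ length Ls * W (z - int l)"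
    by (rule distrib_left)
  also have "\<dots> \<le>
      (\<Sum>zs\<leftarrow>sgns Ls. real_of_int (2 * mabs (z + int l) (max m \<bar>z + int l\<bar>) zs * \<bar>z + int l + disp zs\<bar>
        - (mabs (z + int l) (max m \<bar>z + int l\<bar>) zs)\<^sup>2)) +
      (\<Sum>zs\<leftarrow>sgns Ls. real_of_int (2 * mabs (z - int l) (max m \<bar>z - int l\<bar>) zs * \<bar>z - int l + disp zs\<bar>
        - (mabs (z - int l) (max m \<bar>z - int l\<bar>) zs)\<^sup>2))"
    using Cons.IH[of "z + int l" "max m \<bar>z + int l\<bar>"] Cons.IH[of "z - int l" "max m \<bar>z - int l\<bar>"]
    unfolding W_def by (intro add_mono) auto
  also have "\<dots> = (\<Sum>zs\<leftarrow>sgns (l # Ls). real_of_int (2 * mabs z m zs * \<bar>z + disp zs\<bar> - (mabs z m zs)\<^sup>2))"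
    unfolding sum_list_sgns_Cons sum_list_addf[symmetric]
    by (rule sum_list_cong) (simp add: algebra_simps)
  finally show ?case by (simp only: length_Cons power_Suc mult_ac)
qed simp

text \<open>Doob's maximal inequality.\<close>

lemma sum_mabs_squared_le:
  "(\<Sum>zs\<leftarrow>sgns Ls. (real_of_int (mabs 0 0 zs))\<^sup>2) \<le> 4 * 2 ^ length Ls * sqsum Ls"
proof -
  \<comment> \<open>Let \<open>x\<close> be the maximum and \<open>y\<close> the final modulus.
    Started at 0, the submartingale has a nonnegative sum of \<open>2 x y - x^2\<close>, so twice
    this may be added; pointwise the bound is then \<open>(2 y - x)^2 \<ge> 0\<close>.\<close>
  have "(\<Sum>zs\<leftarrow>sgns Ls. 2 * real_of_int (2 * mabs 0 0 zs * \<bar>0 + disp zs\<bar> - (mabs 0 0 zs)\<^sup>2) +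
        (real_of_int (mabs 0 0 zs))\<^sup>2) \<le> (\<Sum>zs\<leftarrow>sgns Ls. 4 * (real_of_int (0 + disp zs))\<^sup>2)"
  proof (rule sum_list_mono)
    fix zs
    define x y where "x = real_of_int (mabs 0 0 zs)" and "y = real_of_int \<bar>disp zs\<bar>"
    have "0 \<le> (2 * y - x)\<^sup>2" by simp
    then have "2 * (2 * x * y - x\<^sup>2) + x\<^sup>2 \<le> 4 * y\<^sup>2" by (simp add: power2_eq_square algebra_simps)
    then show "2 * real_of_int (2 * mabs 0 0 zs * \<bar>0 + disp zs\<bar> - (mabs 0 0 zs)\<^sup>2) +
        (real_of_int (mabs 0 0 zs))\<^sup>2 \<le> 4 * (real_of_int (0 + disp zs))\<^sup>2"
      by (simp add: x_def y_def)
  qed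
  moreover have "0 \<le> (\<Sum>zs\<leftarrow>sgns Ls. real_of_int (2 * mabs 0 0 zs * \<bar>0 + disp zs\<bar> - (mabs 0 0 zs)\<^sup>2))"
    using mabs_submartingale[of 0 0 Ls] by simp
  moreover have "(\<Sum>zs\<leftarrow>sgns Ls. 4 * (real_of_int (0 + disp zs))\<^sup>2) = 4 * (2 ^ length Ls * sqsum Ls)"
    unfolding sum_list_const_mult sum_disp_squared[of 0] by simp
  ultimately show ?thesis
    by (simp only: sum_list_addf sum_list_const_mult)
qed

text \<open>The inequality \<open>x \<le> t / 2 + x^2 / (2 t)\<close> replaces Cauchy-Schwarz: being
  linear in the second moment, it sums over all block lists with one \<open>t\<close>.\<close>

lemma sum_mabs_le:
  assumes d: "d > 0" and t: "t > 0" "4 * (real L / 2 ^ d) \<le> t\<^sup>2"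
  shows "(\<Sum>Ls\<leftarrow>blks d L. \<Sum>zs\<leftarrow>sgns Ls. real_of_int (mabs 0 0 zs)) \<le> t * R d L"
proof -
  have "(\<Sum>Ls\<leftarrow>blks d L. \<Sum>zs\<leftarrow>sgns Ls. real_of_int (mabs 0 0 zs)) \<le>
      (\<Sum>Ls\<leftarrow>blks d L. t / 2 * 2 ^ length Ls + 2 / t * (2 ^ length Ls * sqsum Ls))"
  proof (rule sum_list_mono)
    fix Ls
    have "(\<Sum>zs\<leftarrow>sgns Ls. real_of_int (mabs 0 0 zs)) \<le>
        (\<Sum>zs\<leftarrow>sgns Ls. t / 2 + 1 / (2 * t) * (real_of_int (mabs 0 0 zs))\<^sup>2)"
    proof (rule sum_list_mono)
      fix zs
      define x where "x = real_of_int (mabs 0 0 zs)"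
      have "0 \<le> (t - x)\<^sup>2" by simp
      then have "2 * t * x \<le> t\<^sup>2 + x\<^sup>2" unfolding power2_diff by linarith
      then show "real_of_int (mabs 0 0 zs) \<le> t / 2 + 1 / (2 * t) * (real_of_int (mabs 0 0 zs))\<^sup>2"
        using t by (simp add: x_def[symmetric] field_simps power2_eq_square)
    qed
    also have "\<dots> = t / 2 * 2 ^ length Ls + 1 / (2 * t) * (\<Sum>zs\<leftarrow>sgns Ls. (real_of_int (mabs 0 0 zs))\<^sup>2)"
      by (simp only: sum_list_addf sum_list_const_mult sum_list_triv length_sgns) simp
    also have "\<dots> \<le> t / 2 * 2 ^ length Ls + 1 / (2 * t) * (4 * 2 ^ length Ls * sqsum Ls)"
      using t by (intro add_left_mono mult_left_mono sum_mabs_squared_le) auto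
    also have "\<dots> = t / 2 * 2 ^ length Ls + 2 / t * (2 ^ length Ls * sqsum Ls)"
      using t by (simp add: field_simps)
    finally show "(\<Sum>zs\<leftarrow>sgns Ls. real_of_int (mabs 0 0 zs)) \<le> \<dots>" .
  qed
  also have "\<dots> = t / 2 * R d L + 2 / t * (\<Sum>Ls\<leftarrow>blks d L. 2 ^ length Ls * sqsum Ls)"
    by (simp only: sum_list_addf sum_list_const_mult R_def)
  also have "\<dots> \<le> t / 2 * R d L + 2 / t * (real L / 2 ^ d * R d L)"
    using t by (intro add_left_mono mult_left_mono sum_sqsum_le[OF d]) auto
  also have "\<dots> \<le> t / 2 * R d L + 2 / t * (t\<^sup>2 / 4 * R d L)"
  proof -
    have "real L / 2 ^ d \<le> t\<^sup>2 / 4" using t(2) by linarith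
    then show ?thesis
      using t(1) by (intro add_left_mono mult_left_mono mult_right_mono) auto
  qed
  also have "\<dots> = t * R d L" using t by (simp add: field_simps power2_eq_square)
  finally show ?thesis .
qed

section \<open>Central binomial coefficients\<close>

lemma central_binomial_even: "(2 * real k + 1) * (real ((2 * k) choose k))\<^sup>2 \<le> 16 ^ k"
proof (induction k)
  case (Suc k)
  define c where "c = real ((2 * k) choose k)"
  have "Suc k * ((2 * Suc k) choose Suc k) = 2 * (Suc (2 * k) * ((2 * k) choose k))"
  proof -
    have "Suc k * ((2 * Suc k) choose Suc k) = (2 * Suc k) * (Suc (2 * k) choose k)"
      using Suc_times_binomial[of k "Suc (2 * k)"] by simp
    also have "Suc (2 * k) choose k = Suc (2 * k) choose Suc k"
      by (subst binomial_symmetric) auto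
    also have "(2 * Suc k) * (Suc (2 * k) choose Suc k) = 2 * (Suc k * (Suc (2 * k) choose Suc k))"
      by simp
    also have "\<dots> = 2 * (Suc (2 * k) * ((2 * k) choose k))"
      by (simp only: Suc_times_binomial)
    finally show ?thesis .
  qed
  then have "real (Suc k * ((2 * Suc k) choose Suc k)) = real (2 * (Suc (2 * k) * ((2 * k) choose k)))"
    by (simp only:)
  then have c': "real ((2 * Suc k) choose Suc k) = 2 * (2 * real k + 1) * c / (real k + 1)"
    unfolding c_def by (simp add: field_simps)
  \<comment> \<open>Consecutive central coefficients have ratio
    \<open>2 (2 k + 1) / (k + 1)\<close>, so the induction step reduces to this inequality.\<close>
  have "(2 * real k + 3) * (2 * real k + 1) \<le> 4 * (real k + 1)\<^sup>2"
    by (simp add: power2_eq_square algebra_simps)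
  then have "(2 * real k + 3) * (2 * real k + 1) * (4 * ((2 * real k + 1) * c\<^sup>2)) \<le>
      4 * (real k + 1)\<^sup>2 * (4 * 16 ^ k)"
    using Suc.IH by (intro mult_mono[of "(2 * real k + 3) * (2 * real k + 1)"]) (simp_all add: c_def)
  then have "(2 * real k + 3) * (2 * real k + 1) * (4 * ((2 * real k + 1) * c\<^sup>2)) / (real k + 1)\<^sup>2 \<le> 16 * 16 ^ k"
    by (subst pos_divide_le_eq) (simp_all add: mult_ac)
  moreover have "(2 * real k + 3) * (2 * (2 * real k + 1) * c / (real k + 1))\<^sup>2 =
      (2 * real k + 3) * (2 * real k + 1) * (4 * ((2 * real k + 1) * c\<^sup>2)) / (real k + 1)\<^sup>2"
    by (simp add: power_divide power_mult_distrib power2_eq_square algebra_simps)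
  ultimately have "(2 * real k + 3) * (2 * (2 * real k + 1) * c / (real k + 1))\<^sup>2 \<le> 16 * 16 ^ k"
    by simp
  then show ?case unfolding c' by (simp add: algebra_simps)
qed simp

lemma central_binomial_le: "real (m choose (m div 2)) * sqrt (real m + 1) \<le> 2 ^ m"
proof -
  have "(real m + 1) * (real (m choose (m div 2)))\<^sup>2 \<le> 4 ^ m"
  proof (cases "even m")
    case True
    then obtain k where k: "m = 2 * k" by (elim evenE)
    show ?thesis using central_binomial_even[of k] by (simp add: k power_mult)
  next
    case False
    then obtain k where k: "m = 2 * k + 1" by (elim oddE)
    have "(2 * Suc k) choose Suc k = 2 * (Suc (2 * k) choose k)"
      using binomial_symmetric[of k "Suc (2 * k)"] by simp
    then have "(2 * real k + 3) * (real (m choose k))\<^sup>2 \<le> 4 * 16 ^ k"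
      using central_binomial_even[of "Suc k"] by (simp add: k algebra_simps)
    moreover have "(real m + 1) * (real (m choose k))\<^sup>2 \<le> (2 * real k + 3) * (real (m choose k))\<^sup>2"
      by (intro mult_right_mono) (auto simp: k)
    ultimately have "(real m + 1) * (real (m choose k))\<^sup>2 \<le> 4 * 16 ^ k" by linarith
    moreover have "m div 2 = k" "(4::real) ^ m = 4 * 16 ^ k" by (auto simp: k power_mult)
    ultimately show ?thesis by simp
  qed
  then have "(real (m choose (m div 2)) * sqrt (real m + 1))\<^sup>2 \<le> (2 ^ m)\<^sup>2"
  proof -
    have "(4::real) ^ m = (2 ^ m)\<^sup>2" by (simp add: power2_eq_square power_mult_distrib[symmetric])
    then show ?thesis using \<open>_ \<le> 4 ^ m\<close> by (simp add: power_mult_distrib mult.commute)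
  qed
  then show ?thesis by (rule power2_le_imp_le) simp
qed

text \<open>The number of sign vectors of length \<open>m\<close> with sum \<open>x\<close>.\<close>

definition srw :: "nat \<Rightarrow> int \<Rightarrow> real" where
  "srw m x = (if - int m \<le> x \<and> even (x + int m) then real (m choose nat ((x + int m) div 2)) else 0)"

lemma srw_0: "srw 0 y = of_bool (y = 0)"
proof (cases "0 \<le> y \<and> even y")
  case True
  then obtain k where "y = 2 * k" "0 \<le> k" by (auto elim!: evenE)
  then show ?thesis by (cases "k = 0") (auto simp: srw_def binomial_eq_0)
qed (auto simp: srw_def)

lemma srw_Suc: "srw m (x - 1) + srw m (x + 1) = srw (Suc m) x"
proof (cases "- int (Suc m) \<le> x \<and> even (x + int (Suc m))")
  case True
  then obtain k where k: "x + int (Suc m) = 2 * k" by (elim conjE evenE)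
  with True have "0 \<le> k" by simp
  then obtain j where j: "k = int j" by (metis nonneg_int_cases)
  then have x: "x = 2 * int j - int m - 1" using k by simp
  show ?thesis
  proof (cases j)
    case 0
    then show ?thesis unfolding x by (simp add: srw_def)
  next
    case (Suc i)
    then show ?thesis unfolding x by (simp add: srw_def nat_add_distrib)
  qed
next
  case False
  then have "srw (Suc m) x = 0" by (auto simp: srw_def)
  moreover have "srw m (x - 1) = 0" "srw m (x + 1) = 0"
    using False by (auto simp: srw_def)
  ultimately show ?thesis by simp
qed

lemma srw_le: "srw m x \<le> 2 ^ m / sqrt (real m + 1)"
proof -
  have "srw m x \<le> real (m choose (m div 2))"
    by (auto simp: srw_def binomial_maximum)
  also have "\<dots> \<le> 2 ^ m / sqrt (real m + 1)"
    using central_binomial_le[of m] by (simp add: field_simps)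
  finally show ?thesis .
qed

text \<open>The index \<open>m\<close> counts the unit blocks processed so far. A further unit block
  is absorbed by Pascal's rule; the sign of any other block only shifts the target, and the bound is
  uniform in the target.\<close>

lemma sum_srw_disp_le:
  "(\<Sum>zs\<leftarrow>sgns Ls. srw m (x - disp zs)) \<le> 2 ^ (length Ls + m) / sqrt (real (count_list Ls 1 + m) + 1)"
proof (induction Ls arbitrary: m x)
  case Nil
  then show ?case using srw_le[of m x] by simp
next
  case (Cons l Ls)
  show ?case
  proof (cases "l = 1")
    case True
    have "(\<Sum>zs\<leftarrow>sgns (l # Ls). srw m (x - disp zs)) = (\<Sum>zs\<leftarrow>sgns Ls. srw (Suc m) (x - disp zs))"
      unfolding sum_list_sgns_Cons srw_Suc[symmetric] by (simp add: True algebra_simps)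
    also have "\<dots> \<le> 2 ^ (length Ls + Suc m) / sqrt (real (count_list Ls 1 + Suc m) + 1)" by (rule Cons.IH)
    finally show ?thesis using True by simp
  next
    case False
    have "(\<Sum>zs\<leftarrow>sgns (l # Ls). srw m (x - disp zs)) =
        (\<Sum>zs\<leftarrow>sgns Ls. srw m (x - int l - disp zs)) + (\<Sum>zs\<leftarrow>sgns Ls. srw m (x + int l - disp zs))"
      unfolding sum_list_sgns_Cons sum_list_addf[symmetric] by (simp add: algebra_simps)
    also have "\<dots> \<le> 2 ^ (length Ls + m) / sqrt (real (count_list Ls 1 + m) + 1) +
        2 ^ (length Ls + m) / sqrt (real (count_list Ls 1 + m) + 1)"
      by (intro add_mono Cons.IH)
    finally show ?thesis using False by simp
  qed
qed

lemma sum_list_sum_swap: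
  "(\<Sum>z\<leftarrow>zs. \<Sum>x\<in>A. f x z :: real) = (\<Sum>x\<in>A. \<Sum>z\<leftarrow>zs. f x z)"
  by (induction zs) (simp_all add: sum.distrib)

lemma small_disp_le:
  "(\<Sum>zs\<leftarrow>sgns Ls. of_bool (\<bar>disp zs\<bar> \<le> int r)) \<le>
    (2 * real r + 1) * (2 ^ length Ls / sqrt (real (count_list Ls 1) + 1))"
proof -
  have "(\<Sum>zs\<leftarrow>sgns Ls. of_bool (\<bar>disp zs\<bar> \<le> int r)) =
      (\<Sum>zs\<leftarrow>sgns Ls. \<Sum>x\<in>{- int r..int r}. srw 0 (x - disp zs))"
  proof (rule sum_list_cong)
    fix zs
    have "(\<Sum>x\<in>{- int r..int r}. srw 0 (x - disp zs)) = (\<Sum>x\<in>{- int r..int r}. if x = disp zs then 1 else 0)"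
      by (intro sum.cong) (auto simp: srw_0)
    also have "\<dots> = of_bool (\<bar>disp zs\<bar> \<le> int r)" by (auto simp: abs_le_iff)
    finally show "of_bool (\<bar>disp zs\<bar> \<le> int r) = (\<Sum>x\<in>{- int r..int r}. srw 0 (x - disp zs))" ..
  qed
  also have "\<dots> = (\<Sum>x\<in>{- int r..int r}. \<Sum>zs\<leftarrow>sgns Ls. srw 0 (x - disp zs))"
    by (rule sum_list_sum_swap)
  also have "\<dots> \<le> (\<Sum>x\<in>{- int r..int r}. 2 ^ length Ls / sqrt (real (count_list Ls 1) + 1))"
    using sum_srw_disp_le[where m = 0] by (intro sum_mono) simp
  also have "\<dots> = (2 * real r + 1) * (2 ^ length Ls / sqrt (real (count_list Ls 1) + 1))"
    by simp
  finally show ?thesis .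
qed

lemma sum_small_disp_le:
  assumes d: "d > 0"
  shows "(\<Sum>Ls\<leftarrow>blks d L. \<Sum>zs\<leftarrow>sgns Ls. of_bool (\<bar>disp zs\<bar> \<le> int r)) \<le>
    (2 * 4 ^ M / \<nu> d ^ L + (2 * real r + 1) / sqrt (real M + 1)) * R d L"
proof -
  have "(\<Sum>Ls\<leftarrow>blks d L. \<Sum>zs\<leftarrow>sgns Ls. of_bool (\<bar>disp zs\<bar> \<le> int r) :: real) \<le>
      (\<Sum>Ls\<leftarrow>blks d L. 2 ^ length Ls * of_bool (count_list Ls 1 < M) +
        (2 * real r + 1) / sqrt (real M + 1) * 2 ^ length Ls)"
  proof (rule sum_list_mono)
    fix Ls
    let ?s = "\<Sum>zs\<leftarrow>sgns Ls. of_bool (\<bar>disp zs\<bar> \<le> int r) :: real"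
    have "?s \<le> (\<Sum>zs\<leftarrow>sgns Ls. 1)" by (intro sum_list_mono) auto
    then have 1: "?s \<le> 2 ^ length Ls" by (simp add: sum_list_triv)
    show "?s \<le> 2 ^ length Ls * of_bool (count_list Ls 1 < M) +
        (2 * real r + 1) / sqrt (real M + 1) * 2 ^ length Ls"
    proof (cases "count_list Ls 1 < M")
      case True
      then show ?thesis using 1 by (simp add: add_increasing2)
    next
      case False
      have "?s \<le> (2 * real r + 1) * (2 ^ length Ls / sqrt (real (count_list Ls 1) + 1))"
        by (rule small_disp_le)
      also have "\<dots> \<le> (2 * real r + 1) * (2 ^ length Ls / sqrt (real M + 1))"
        using False by (intro mult_left_mono divide_left_mono) auto
      finally show ?thesis using False by simp
    qed
  qed
  also have "\<dots> = (\<Sum>Ls\<leftarrow>blks d L. 2 ^ length Ls * of_bool (count_list Ls 1 < M)) +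
      (2 * real r + 1) / sqrt (real M + 1) * R d L"
    by (simp only: sum_list_addf sum_list_const_mult R_def)
  also have "\<dots> \<le> 2 * 4 ^ M / \<nu> d ^ L * R d L + (2 * real r + 1) / sqrt (real M + 1) * R d L"
    by (intro add_right_mono few_ones[OF d])
  finally show ?thesis by (simp add: algebra_simps)
qed

section \<open>The size of the range\<close>

lemma prob_unif_Hom:
  "measure_pmf.prob (unif_Hom n d) {f. P (card (Rng n f))} =
    (\<Sum>f\<in>Hom_P n d. of_bool (P (card (Rng n f)))) / real (card (Hom_P n d))"
  unfolding unif_Hom_def
  by (simp add: measure_pmf_of_set[OF Hom_P_nonempty finite_Hom_P] sum.If_cases finite_Hom_P
      of_bool_def Int_def)

lemma expectation_unif_Hom:
  "measure_pmf.expectation (unif_Hom n d) (\<lambda>f. real (card (Rng n f))) =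
    (\<Sum>f\<in>Hom_P n d. real (card (Rng n f))) / real (card (Hom_P n d))"
  unfolding unif_Hom_def by (rule integral_pmf_of_set[OF Hom_P_nonempty finite_Hom_P])

lemma card_Hom_P_pos: "0 < card (Hom_P n d)"
  using Hom_P_nonempty finite_Hom_P by (simp add: card_gt_0_iff)

text \<open>The term \<open>2 * a\<close> accounts for the two functions without turns. The others
  are grouped by the number \<open>L\<close> of bits after the first turn and obey
  \<open>card_phases\<close>.\<close>

lemma sum_card_Rng_le:
  fixes g :: "nat \<Rightarrow> real" and h :: "(int \<times> nat) list \<Rightarrow> real"
  assumes n: "n > 0" and d: "d > 0"
    and small: "\<And>k. k \<le> 2 \<Longrightarrow> g k \<le> a"
    and large: "\<And>k zs. 3 \<le> k \<Longrightarrow> int k \<le> 2 * mabs 0 0 zs + 3 \<Longrightarrow> \<bar>disp zs\<bar> \<le> int k + 1 \<Longrightarrow> g k \<le> h zs"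
  shows "(\<Sum>f\<in>Hom_P n d. g (card (Rng n f))) \<le>
    2 * a + (\<Sum>L<n - 1. \<Sum>Ls\<leftarrow>blks d L. \<Sum>zs\<leftarrow>sgns Ls. h zs)"
proof -
  have "(\<Sum>f\<in>Hom_P n d. g (card (Rng n f))) \<le> a + a +
      (\<Sum>p<n - 1. \<Sum>Ls\<leftarrow>blks d (n - 2 - p). \<Sum>zs\<leftarrow>sgns Ls. h zs)"
    unfolding sum_Hom_P_blks[OF n d, of "\<lambda>S. g (card S)"]
    by (intro add_mono sum_mono sum_list_mono small large card_walk_alternating card_phases) auto
  also have "(\<Sum>p<n - 1. \<Sum>Ls\<leftarrow>blks d (n - 2 - p). \<Sum>zs\<leftarrow>sgns Ls. h zs) =
      (\<Sum>p<n - 1. \<Sum>Ls\<leftarrow>blks d (n - 1 - Suc p). \<Sum>zs\<leftarrow>sgns Ls. h zs)"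
    by (simp add: numeral_2_eq_2)
  also have "\<dots> = (\<Sum>L<n - 1. \<Sum>Ls\<leftarrow>blks d L. \<Sum>zs\<leftarrow>sgns Ls. h zs)"
    by (rule sum.nat_diff_reindex)
  finally show ?thesis by simp
qed

lemma card_Hom_P:
  assumes n: "n > 0" and d: "d > 0"
  shows "real (card (Hom_P n d)) = 2 + (\<Sum>L<n - 1. R d L)"
proof -
  have "real (card (Hom_P n d)) = 2 + (\<Sum>p<n - 1. R d (n - 1 - Suc p))"
    using sum_Hom_P_blks[OF n d, of "\<lambda>_. 1"] by (simp add: R_def sum_list_triv numeral_2_eq_2)
  also have "(\<Sum>p<n - 1. R d (n - 1 - Suc p)) = (\<Sum>L<n - 1. R d L)"
    by (rule sum.nat_diff_reindex)
  finally show ?thesis .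
qed

lemma R_squared_ge: "2 ^ (L + 1) \<le> (R d L)\<^sup>2"
proof (induction L rule: less_induct)
  case (less L)
  consider "L = 0" | "L = 1" | "2 \<le> L" by linarith
  then show ?case
  proof cases
    case 3
    define z where "z = L - 2"
    then have L: "L = z + 2" using 3 by simp
    have "2 ^ (L + 1) = 4 * (2::real) ^ (z + 1)" by (simp add: L)
    also have "\<dots> \<le> 4 * (R d z)\<^sup>2" using less.IH[of z] L by simp
    also have "\<dots> = (2 * R d z)\<^sup>2" by (simp add: power2_eq_square)
    also have "\<dots> \<le> (R d L)\<^sup>2" unfolding L by (intro power_mono R_ge_double) simp
    finally show ?thesis .
  qed (simp_all add: R_rec)
qed

text \<open>Squaring avoids half-integer exponents. For \<open>n \<ge> 3\<close> the last two terms
  of the sum in \<open>card_Hom_P\<close> already suffice, by \<open>R_squared_ge\<close>.\<close>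

lemma card_Hom_P_ge:
  assumes n: "n > 0" and d: "d > 0"
  shows "2 powr (real n / 2) \<le> real (card (Hom_P n d))"
proof -
  have "2 ^ n \<le> (real (card (Hom_P n d)))\<^sup>2"
  proof -
    consider "n = 1" | "n = 2" | k where "n = k + 3"
      using n by (metis One_nat_def Suc_1 add.commute add_Suc_right less_nat_zero_code not0_implies_Suc numeral_3_eq_3 plus_1_eq_Suc)
    then show ?thesis
    proof cases
      case (3 k)
      define a b where "a = R d (k + 1)" and "b = R d k"
      have "b \<le> a" "0 \<le> b" unfolding a_def b_def by (auto intro: R_mono)
      have a: "4 * 2 ^ k \<le> a\<^sup>2" and b: "2 * 2 ^ k \<le> b\<^sup>2"
        using R_squared_ge[of "k + 1" d] R_squared_ge[of k d] by (simp_all add: a_def b_def)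
      have "b * b \<le> a * b" using \<open>b \<le> a\<close> \<open>0 \<le> b\<close> by (rule mult_right_mono)
      moreover have "(2::real) ^ n = 8 * 2 ^ k" by (simp add: 3 power_add)
      moreover have "(0::real) \<le> 2 ^ k" by simp
      moreover have "(a + b)\<^sup>2 = a\<^sup>2 + b\<^sup>2 + 2 * (a * b)" by (simp add: power2_sum)
      ultimately have "2 ^ n \<le> (a + b)\<^sup>2"
        using a b by (simp only: power2_eq_square[of b])
      also have "\<dots> \<le> (real (card (Hom_P n d)))\<^sup>2"
      proof (rule power_mono)
        have "(\<Sum>L<n - 1. R d L) = (\<Sum>L<k. R d L) + b + a"
          by (simp add: 3 a_def b_def numeral_3_eq_3)
        moreover have "0 \<le> (\<Sum>L<k. R d L)" by (intro sum_nonneg) simp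
        ultimately show "a + b \<le> real (card (Hom_P n d))"
          unfolding card_Hom_P[OF n d] by simp
      qed (use \<open>b \<le> a\<close> \<open>0 \<le> b\<close> in simp)
      finally show ?thesis .
    qed (use card_Hom_P[OF n d] in \<open>simp_all add: R_rec\<close>)
  qed
  moreover have "(2 powr (real n / 2))\<^sup>2 = 2 ^ n"
  proof -
    have "(2 powr (real n / 2))\<^sup>2 = 2 powr (real n / 2 + real n / 2)"
      by (simp only: powr_add power2_eq_square)
    also have "\<dots> = 2 powr real n" by (rule arg_cong[of _ _ "\<lambda>x. 2 powr x"]) simp
    also have "\<dots> = 2 ^ n" by (rule powr_realpow) simp
    finally show ?thesis .
  qed
  ultimately have "(2 powr (real n / 2))\<^sup>2 \<le> (real (card (Hom_P n d)))\<^sup>2" by (simp only:)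
  then show ?thesis by (rule power2_le_imp_le) simp
qed

lemma two_div_card_Hom_P_le:
  assumes n: "n > 0" and d: "d > 0"
  shows "2 / real (card (Hom_P n d)) \<le> 2 powr (1 - real n / 2)"
proof -
  have "2 / real (card (Hom_P n d)) \<le> 2 / 2 powr (real n / 2)"
    using card_Hom_P_ge[OF n d] by (intro divide_left_mono mult_pos_pos) (auto simp: card_Hom_P_pos)
  also have "\<dots> = 2 powr (1 - real n / 2)" by (simp add: powr_diff)
  finally show ?thesis .
qed

section \<open>Upper bound for the expected size of the range\<close>

lemma expectation_le:
  assumes n: "n > 0" and d: "d > 0"
  shows "measure_pmf.expectation (unif_Hom n d) (\<lambda>f. real (card (Rng n f))) \<le>
    3 + 4 * sqrt (real n / 2 ^ d)"
proof -
  define t where "t = 2 * sqrt (real n / 2 ^ d)"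
  have t: "t > 0" using n by (simp add: t_def)
  have t2: "4 * (real L / 2 ^ d) \<le> t\<^sup>2" if "L < n - 1" for L
    using that by (simp add: t_def power_mult_distrib divide_right_mono)
  have "(\<Sum>f\<in>Hom_P n d. real (card (Rng n f))) \<le>
      2 * 3 + (\<Sum>L<n - 1. \<Sum>Ls\<leftarrow>blks d L. \<Sum>zs\<leftarrow>sgns Ls. 2 * real_of_int (mabs 0 0 zs) + 3)"
  proof (rule sum_card_Rng_le[OF n d])
    fix k zs assume "int k \<le> 2 * mabs 0 0 zs + 3"
    then have "real_of_int (int k) \<le> real_of_int (2 * mabs 0 0 zs + 3)" by (simp only: of_int_le_iff)
    then show "real k \<le> 2 * real_of_int (mabs 0 0 zs) + 3" by simp
  qed auto
  also have "\<dots> \<le> 2 * 3 + (\<Sum>L<n - 1. (2 * t + 3) * R d L)"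
  proof (intro add_left_mono sum_mono)
    fix L assume "L \<in> {..<n - 1}"
    have "(\<Sum>Ls\<leftarrow>blks d L. \<Sum>zs\<leftarrow>sgns Ls. 2 * real_of_int (mabs 0 0 zs) + 3) =
        2 * (\<Sum>Ls\<leftarrow>blks d L. \<Sum>zs\<leftarrow>sgns Ls. real_of_int (mabs 0 0 zs)) + 3 * R d L"
      by (simp only: sum_list_addf sum_list_const_mult sum_list_triv length_sgns R_def)
         (simp add: sum_list_const_mult[symmetric] mult.commute)
    also have "\<dots> \<le> 2 * (t * R d L) + 3 * R d L"
      using \<open>L \<in> {..<n - 1}\<close> t2 t by (intro add_right_mono mult_left_mono sum_mabs_le[OF d]) auto
    finally show "(\<Sum>Ls\<leftarrow>blks d L. \<Sum>zs\<leftarrow>sgns Ls. 2 * real_of_int (mabs 0 0 zs) + 3) \<le> (2 * t + 3) * R d L"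
      by (simp add: algebra_simps)
  qed
  also have "\<dots> = 2 * 3 + (2 * t + 3) * (\<Sum>L<n - 1. R d L)" by (simp only: sum_distrib_left)
  also have "\<dots> \<le> (3 + 2 * t) * real (card (Hom_P n d))"
    using t by (simp add: card_Hom_P[OF n d] algebra_simps)
  finally show ?thesis
    unfolding expectation_unif_Hom using card_Hom_P_pos[of n d]
    by (simp add: pos_divide_le_eq t_def)
qed

section \<open>Probability of a small range\<close>

lemma prob_lt_3:
  assumes n: "n > 0" and d: "d > 0"
  shows "measure_pmf.prob (unif_Hom n d) {f. card (Rng n f) < 3} \<le> 2 powr (1 - real n / 2)"
proof -
  have "(\<Sum>f\<in>Hom_P n d. of_bool (card (Rng n f) < 3) :: real) \<le>
      2 * 1 + (\<Sum>L<n - 1. \<Sum>Ls\<leftarrow>blks d L. \<Sum>zs\<leftarrow>sgns Ls. 0)"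
    by (rule sum_card_Rng_le[OF n d, where g = "\<lambda>k. of_bool (k < 3)"]) auto
  then have "(\<Sum>f\<in>Hom_P n d. of_bool (card (Rng n f) < 3)) \<le> (2 :: real)"
    by (simp add: sum_list_triv)
  then have "(\<Sum>f\<in>Hom_P n d. of_bool (card (Rng n f) < 3)) / real (card (Hom_P n d)) \<le>
      2 / real (card (Hom_P n d))"
    by (rule divide_right_mono) simp
  then show ?thesis
    unfolding prob_unif_Hom[of n d "\<lambda>k. k < 3"]
    by (rule order_trans[OF _ two_div_card_Hom_P_le[OF n d]])
qed

text \<open>Used to show that functions with a late first turn, which leaves few bits, form an
  exponentially small share.\<close>

lemma sum_R_ge_pow: "2 ^ j * (\<Sum>L<l. R d L) \<le> (\<Sum>L<l + 2 * j. R d L)"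
proof -
  have "2 ^ j * (\<Sum>L<l. R d L) \<le> (\<Sum>L<l. R d (L + 2 * j))"
    unfolding sum_distrib_left by (intro sum_mono R_ge_pow)
  also have "\<dots> = (\<Sum>L\<in>{2 * j..<l + 2 * j}. R d L)"
    using sum.shift_bounds_nat_ivl[of "R d" 0 "2 * j" l] by (simp add: atLeast0LessThan)
  also have "\<dots> \<le> (\<Sum>L<l + 2 * j. R d L)"
    by (intro sum_mono2) auto
  finally show ?thesis .
qed

text \<open>The denominator is at least \<open>exp (Y / 800)\<close>, from
  \<open>exp (y / 2) \<le> \<nu> d\<close> and \<open>n \<le> 4 L\<close>; the numerator is at most
  \<open>exp (Y / 1600)\<close>, from \<open>4 \<le> exp 2\<close>.\<close>

lemma inverse_\<nu>_pow_le:
  assumes Y: "Y = real n / 2 ^ d" and L: "real n \<le> 4 * real L" and M: "real M \<le> Y / 3200"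
  shows "4 ^ M / \<nu> d ^ L \<le> exp (- (Y / 1600))"
proof -
  define y where "y = 1 / (100 * 2 ^ d :: real)"
  have "(1::real) \<le> 2 ^ d" by simp
  then have "(1::real) \<le> 100 * 2 ^ d" by linarith
  then have y: "0 < y" "y \<le> 1" by (simp_all add: y_def)
  have "exp (y / 2) \<le> 1 + y / 2 + (y / 2)\<^sup>2" using y by (intro exp_bound) auto
  also have "\<dots> \<le> 1 + y"
  proof -
    have "y * y \<le> y * 1" using y by (intro mult_left_mono) auto
    then have "(y / 2)\<^sup>2 \<le> y / 4" by (simp add: power2_eq_square)
    then show ?thesis using y by linarith
  qed
  finally have "exp (y / 2) \<le> \<nu> d" by (simp add: \<nu>_def y_def)
  then have "exp (y / 2) ^ L \<le> \<nu> d ^ L" by (intro power_mono) auto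
  moreover have "exp (y / 2) ^ L = exp (real L * (y / 2))" by (rule exp_of_nat_mult[symmetric])
  moreover have "Y / 800 \<le> real L * (y / 2)"
    using L by (simp add: Y y_def field_simps)
  ultimately have \<nu>: "exp (Y / 800) \<le> \<nu> d ^ L" by (smt (verit) exp_le_cancel_iff)
  have "(2::real) \<le> exp 1" using exp_ge_add_one_self[of 1] by simp
  then have "2 * 2 \<le> exp 1 * exp (1::real)" by (intro mult_mono) auto
  then have "(4::real) ^ M \<le> exp 2 ^ M" by (intro power_mono) (auto simp: exp_add[symmetric])
  also have "\<dots> = exp (real M * 2)" by (rule exp_of_nat_mult[symmetric])
  also have "\<dots> \<le> exp (Y / 1600)" using M by simp
  finally have "4 ^ M / \<nu> d ^ L \<le> exp (Y / 1600) / exp (Y / 800)"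
    using \<nu> by (intro frac_le) auto
  also have "\<dots> = exp (- (Y / 1600))" by (simp add: exp_diff[symmetric])
  finally show ?thesis .
qed

lemma prob_lt:
  assumes n: "n > 0" and d: "d > 0" and \<delta>: "0 < \<delta>" "\<delta> \<le> 1 / 2"
  shows "measure_pmf.prob (unif_Hom n d)
      {f. real (card (Rng n f)) < 3 + real_of_int \<lfloor>\<delta> * sqrt (real n / 2 ^ d)\<rfloor>}
    \<le> 3000 * \<delta> + 2 powr (1 - real n / 2)"
proof -
  define Y where "Y = real n / 2 ^ d"
  define F where "F = \<lfloor>\<delta> * sqrt Y\<rfloor>"
  have "0 \<le> F" using \<delta> by (simp add: F_def Y_def)
  have lt_iff: "real k < 3 + real_of_int F \<longleftrightarrow> int k < 3 + F" for k by linarith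
  show ?thesis
  proof (cases "F = 0")
    case True
    then show ?thesis
      using prob_lt_3[OF n d] \<delta> unfolding F_def[symmetric] Y_def[symmetric] by simp
  next
    case False
    \<comment> \<open>A range below \<open>3 + F\<close> has at most \<open>F + 2\<close> points, so
      \<open>card_phases\<close> bounds the displacement by \<open>F + 3\<close>.\<close>
    define r where "r = nat F + 3"
    \<comment> \<open>The cut \<open>L0\<close> is about \<open>n / 2\<close>: shorter continuations
      are outnumbered by a factor \<open>2 ^ j\<close>, while the others still have
      \<open>L \<ge> n / 4\<close>.\<close>
    define j where "j = n div 4"
    define L0 where "L0 = n - 1 - 2 * j"
    define M where "M = nat \<lfloor>Y / 3200\<rfloor>"
    define G where "G = (\<Sum>L<n - 1. R d L)"
    define B where "B = 2 * 4 ^ M / \<nu> d ^ L0 + (2 * real r + 1) / sqrt (real M + 1)"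
    \<comment> \<open>A nonzero \<open>F\<close> forces \<open>Y \<ge> 1 / \<delta>^2\<close>, so
      error terms that decay in \<open>Y\<close> become multiples of
      \<open>\<delta>\<close>.\<close>
    have F1: "1 \<le> \<delta> * sqrt Y" using False \<open>0 \<le> F\<close> unfolding F_def by linarith
    have "0 \<le> Y" by (simp add: Y_def)
    have "1\<^sup>2 \<le> (\<delta> * sqrt Y)\<^sup>2" using F1 by (intro power_mono) auto
    then have Y1: "1 \<le> \<delta>\<^sup>2 * Y" using \<open>0 \<le> Y\<close> by (simp add: power_mult_distrib)
    have "\<delta>\<^sup>2 \<le> (1 / 2)\<^sup>2" using \<delta> by (intro power_mono) auto
    then have "\<delta>\<^sup>2 * Y \<le> 1 / 4 * Y" using \<open>0 \<le> Y\<close> by (intro mult_right_mono) (auto simp: power2_eq_square)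
    then have Y4: "4 \<le> Y" using Y1 by linarith
    have iY: "1 / Y \<le> \<delta> / 2"
    proof -
      have "1 / Y \<le> \<delta>\<^sup>2" using Y1 Y4 by (simp add: field_simps)
      also have "\<dots> \<le> \<delta> * (1 / 2)" unfolding power2_eq_square using \<delta> by (intro mult_left_mono) auto
      finally show ?thesis by simp
    qed
    have "(2::real) ^ 1 \<le> 2 ^ d" using d by (intro power_increasing) auto
    then have "Y * 2 \<le> Y * 2 ^ d" using \<open>0 \<le> Y\<close> by (intro mult_left_mono) auto
    moreover have "Y * 2 ^ d = real n" by (simp add: Y_def)
    ultimately have nY: "2 * Y \<le> real n" by linarith
    then have n8: "8 \<le> n" using Y4 by linarith
    have L0: "n - 1 = L0 + 2 * j" "real n \<le> 4 * real L0"
      using n8 unfolding L0_def j_def by linarith+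
    have M: "real M \<le> Y / 3200" "Y / 3200 \<le> real M + 1"
      using Y4 unfolding M_def by linarith+
    have G: "0 \<le> G" by (simp add: G_def sum_nonneg)

    have "(\<Sum>f\<in>Hom_P n d. of_bool (real (card (Rng n f)) < 3 + real_of_int F) :: real) \<le>
        2 * 1 + (\<Sum>L<n - 1. \<Sum>Ls\<leftarrow>blks d L. \<Sum>zs\<leftarrow>sgns Ls. of_bool (\<bar>disp zs\<bar> \<le> int r))"
      unfolding lt_iff
      by (rule sum_card_Rng_le[OF n d, where g = "\<lambda>k. of_bool (int k < 3 + F)"])
         (use \<open>0 \<le> F\<close> in \<open>auto simp: r_def\<close>)
    also have "\<dots> \<le> 2 * 1 + ((\<Sum>L<L0. R d L) + B * G)"
    proof (rule add_left_mono)
      have "(\<Sum>L<n - 1. \<Sum>Ls\<leftarrow>blks d L. \<Sum>zs\<leftarrow>sgns Ls. of_bool (\<bar>disp zs\<bar> \<le> int r)) \<le>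
          (\<Sum>L<n - 1. of_bool (L < L0) * R d L + B * R d L)"
      proof (rule sum_mono)
        fix L
        show "(\<Sum>Ls\<leftarrow>blks d L. \<Sum>zs\<leftarrow>sgns Ls. of_bool (\<bar>disp zs\<bar> \<le> int r)) \<le> of_bool (L < L0) * R d L + B * R d L"
        proof (cases "L < L0")
          case True
          have "(\<Sum>Ls\<leftarrow>blks d L. \<Sum>zs\<leftarrow>sgns Ls. of_bool (\<bar>disp zs\<bar> \<le> int r)) \<le>
              (\<Sum>Ls\<leftarrow>blks d L. \<Sum>zs\<leftarrow>sgns Ls. 1 :: real)"
            by (intro sum_list_mono) auto
          also have "\<dots> = R d L" by (simp add: R_def sum_list_triv)
          also have "\<dots> \<le> R d L + B * R d L"
            using \<nu>_ge_1[of d] by (simp add: B_def)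
          finally show ?thesis using True by simp
        next
          case False
          have "(\<Sum>Ls\<leftarrow>blks d L. \<Sum>zs\<leftarrow>sgns Ls. of_bool (\<bar>disp zs\<bar> \<le> int r)) \<le>
              (2 * 4 ^ M / \<nu> d ^ L + (2 * real r + 1) / sqrt (real M + 1)) * R d L"
            by (rule sum_small_disp_le[OF d])
          also have "\<dots> \<le> B * R d L"
            unfolding B_def using False \<nu>_ge_1[of d]
            by (intro mult_right_mono add_right_mono divide_left_mono power_increasing mult_pos_pos) auto
          finally show ?thesis using False by simp
        qed
      qed
      also have "\<dots> = (\<Sum>L<n - 1. of_bool (L < L0) * R d L) + B * G"
        by (simp add: sum.distrib sum_distrib_left G_def)
      also have "(\<Sum>L<n - 1. of_bool (L < L0) * R d L) = (\<Sum>L<L0. R d L)"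
        using L0 by (intro sum.mono_neutral_cong_right) auto
      finally show "(\<Sum>L<n - 1. \<Sum>Ls\<leftarrow>blks d L. \<Sum>zs\<leftarrow>sgns Ls. of_bool (\<bar>disp zs\<bar> \<le> int r)) \<le>
          (\<Sum>L<L0. R d L) + B * G" .
    qed
    also have "(\<Sum>L<L0. R d L) \<le> \<delta> * G"
    proof -
      have "real j + 1 \<le> 2 ^ j" by (induction j) auto
      then have "real n / 4 \<le> 2 ^ j" unfolding j_def by linarith
      then have "Y / 2 \<le> 2 ^ j" using nY by linarith
      then have "1 / 2 ^ j \<le> 1 / (Y / 2)" using Y4 by (intro divide_left_mono) auto
      also have "\<dots> \<le> \<delta>" using iY by simp
      finally have "1 / 2 ^ j * G \<le> \<delta> * G" using G by (rule mult_right_mono)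
      moreover have "(\<Sum>L<L0. R d L) \<le> 1 / 2 ^ j * G"
        using sum_R_ge_pow[of j d L0] unfolding G_def L0(1) by (simp add: field_simps)
      ultimately show ?thesis by linarith
    qed
    \<comment> \<open>Too few unit blocks cost \<open>1600 * \<delta>\<close>; anticoncentration
      costs \<open>9 * 60 * \<delta>\<close>. The remaining \<open>\<delta>\<close> up to 3000 is
      for the short continuations.\<close>
    also have "B \<le> 2999 * \<delta>"
    proof -
      have "exp (- (Y / 1600)) \<le> 1 / (Y / 1600)"
      proof -
        have "Y / 1600 \<le> exp (Y / 1600)" using exp_ge_add_one_self[of "Y / 1600"] by linarith
        then have "1 / exp (Y / 1600) \<le> 1 / (Y / 1600)" using Y4 by (intro divide_left_mono) auto
        then show ?thesis by (simp add: exp_minus inverse_eq_divide)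
      qed
      then have "4 ^ M / \<nu> d ^ L0 \<le> 1600 * (1 / Y)"
        using inverse_\<nu>_pow_le[OF Y_def L0(2) M(1)] by simp
      then have 1: "2 * 4 ^ M / \<nu> d ^ L0 \<le> 1600 * \<delta>" using iY by simp
      have "sqrt Y / 60 = sqrt (Y / 3600)" by (simp add: real_sqrt_divide)
      also have "\<dots> \<le> sqrt (real M + 1)" using M(2) Y4 by simp
      finally have s: "sqrt Y / 60 \<le> sqrt (real M + 1)" .
      have "real r = real_of_int F + 3" using \<open>0 \<le> F\<close> by (simp add: r_def)
      then have "2 * real r + 1 \<le> 9 * (\<delta> * sqrt Y)" using F1 unfolding F_def by linarith
      then have "(2 * real r + 1) / sqrt (real M + 1) \<le> 9 * (\<delta> * sqrt Y) / (sqrt Y / 60)"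
        using s Y4 F1 by (intro frac_le) auto
      also have "\<dots> = 540 * \<delta>" using Y4 by simp
      finally show ?thesis using 1 \<delta> by (simp add: B_def)
    qed
    finally have "(\<Sum>f\<in>Hom_P n d. of_bool (real (card (Rng n f)) < 3 + real_of_int F)) \<le> 2 + 3000 * \<delta> * G"
      using G by (simp add: mult_right_mono algebra_simps)
    also have "\<dots> \<le> 2 + 3000 * \<delta> * real (card (Hom_P n d))"
      using \<delta> by (intro add_left_mono mult_left_mono) (auto simp: G_def card_Hom_P[OF n d])
    finally have "(\<Sum>f\<in>Hom_P n d. of_bool (real (card (Rng n f)) < 3 + real_of_int F)) / real (card (Hom_P n d))
        \<le> (2 + 3000 * \<delta> * real (card (Hom_P n d))) / real (card (Hom_P n d))"
      by (rule divide_right_mono) simp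
    also have "\<dots> = 2 / real (card (Hom_P n d)) + 3000 * \<delta>"
      using card_Hom_P_pos[of n d] by (simp add: add_divide_distrib)
    also have "\<dots> \<le> 3000 * \<delta> + 2 powr (1 - real n / 2)"
      using two_div_card_Hom_P_le[OF n d] by simp
    finally show ?thesis
      unfolding prob_unif_Hom[of n d "\<lambda>k. real k < 3 + _"] F_def Y_def .
  qed
qed

text \<open>The bound holds pointwise before averaging: a range always has two points, at least
  three off the first event, and at least \<open>3 + F\<close> off the second.\<close>

lemma expectation_ge:
  assumes n: "n > 0" and F: "0 \<le> (F::int)"
  shows "3 - measure_pmf.prob (unif_Hom n d) {f. card (Rng n f) < 3} +
      real_of_int F * (1 - measure_pmf.prob (unif_Hom n d) {f. real (card (Rng n f)) < 3 + real_of_int F})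
    \<le> measure_pmf.expectation (unif_Hom n d) (\<lambda>f. real (card (Rng n f)))"
proof -
  define H where "H = real (card (Hom_P n d))"
  have H: "H > 0" using card_Hom_P_pos by (simp add: H_def)
  have "(\<Sum>f\<in>Hom_P n d. 3 - of_bool (card (Rng n f) < 3) +
      real_of_int F * (1 - of_bool (real (card (Rng n f)) < 3 + real_of_int F))) \<le> (\<Sum>f\<in>Hom_P n d. real (card (Rng n f)))"
  proof (rule sum_mono)
    fix f assume f: "f \<in> Hom_P n d"
    have "f 0 \<noteq> f 1" using Hom_P_step[OF f, of 0] n by auto
    then have "2 = card {f 0, f 1}" by simp
    also have "\<dots> \<le> card (Rng n f)"
      unfolding Rng_def P_verts_def using n by (intro card_mono) auto
    finally have "2 \<le> card (Rng n f)" .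
    then show "3 - of_bool (card (Rng n f) < 3) +
        real_of_int F * (1 - of_bool (real (card (Rng n f)) < 3 + real_of_int F)) \<le> real (card (Rng n f))"
      using F by auto
  qed
  moreover have "(\<Sum>f\<in>Hom_P n d. 3 - of_bool (card (Rng n f) < 3) +
      real_of_int F * (1 - of_bool (real (card (Rng n f)) < 3 + real_of_int F))) =
      3 * H - (\<Sum>f\<in>Hom_P n d. of_bool (card (Rng n f) < 3)) +
      real_of_int F * (H - (\<Sum>f\<in>Hom_P n d. of_bool (real (card (Rng n f)) < 3 + real_of_int F)))"
    by (simp only: sum.distrib sum_subtractf sum_distrib_left[symmetric] sum_constant H_def) simp
  ultimately have "(3 * H - (\<Sum>f\<in>Hom_P n d. of_bool (card (Rng n f) < 3)) +
      real_of_int F * (H - (\<Sum>f\<in>Hom_P n d. of_bool (real (card (Rng n f)) < 3 + real_of_int F)))) / H \<le>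
      (\<Sum>f\<in>Hom_P n d. real (card (Rng n f))) / H"
    using H by (intro divide_right_mono) auto
  moreover have "(3 * H - x + real_of_int F * (H - y)) / H = 3 - x / H + real_of_int F * (1 - y / H)" for x y
    using H by (simp add: field_simps)
  ultimately show ?thesis
    unfolding expectation_unif_Hom prob_unif_Hom[of n d "\<lambda>k. k < 3"]
      prob_unif_Hom[of n d "\<lambda>k. real k < 3 + real_of_int F"] H_def[symmetric] by simp
qed

lemma sqrt_mult_powr: "sqrt (real n * 2 powr (- real d)) = sqrt (real n / 2 ^ d)"
  by (simp add: powr_minus powr_realpow divide_inverse)

theorem theorem2p3:
  shows "(\<exists>C c :: real. C > 0 \<and> c > 0 \<and>
            (\<forall>n d :: nat. n > 0 \<longrightarrow> d > 0 \<longrightarrow>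
               3 + real_of_int \<lfloor>c * sqrt (real n * 2 powr (- real d))\<rfloor> - 2 powr (1 - real n / 2)
                 \<le> measure_pmf.expectation (unif_Hom n d) (\<lambda>f. real (card (Rng n f))) \<and>
               measure_pmf.expectation (unif_Hom n d) (\<lambda>f. real (card (Rng n f)))
                 \<le> 3 + C * sqrt (real n * 2 powr (- real d))))
       \<and> (\<forall>\<epsilon> :: real. \<epsilon> > 0 \<longrightarrow> (\<exists>\<delta> :: real. \<delta> > 0 \<and>
            (\<forall>n d :: nat. n > 0 \<longrightarrow> d > 0 \<longrightarrow>
               measure_pmf.prob (unif_Hom n d)
                   {f. real (card (Rng n f))
                         < 3 + real_of_int \<lfloor>\<delta> * sqrt (real n * 2 powr (- real d))\<rfloor>}
                 \<le> \<epsilon> + 2 powr (1 - real n / 2))))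
       \<and> (\<forall>d :: nat \<Rightarrow> nat. (\<forall>n > 0. d n > 0) \<longrightarrow>
            filterlim (\<lambda>n. real (d n) - log 2 (real n)) at_bot sequentially \<longrightarrow>
            (\<forall>r :: nat. r > 0 \<longrightarrow>
               (\<lambda>n. measure_pmf.prob (unif_Hom n (d n)) {f. card (Rng n f) \<le> r})
                 \<longlonglongrightarrow> 0))"
  unfolding sqrt_mult_powr
proof (intro conjI allI impI)
  show "\<exists>C c :: real. C > 0 \<and> c > 0 \<and>
      (\<forall>n d :: nat. n > 0 \<longrightarrow> d > 0 \<longrightarrow>
         3 + real_of_int \<lfloor>c * sqrt (real n / 2 ^ d)\<rfloor> - 2 powr (1 - real n / 2)
           \<le> measure_pmf.expectation (unif_Hom n d) (\<lambda>f. real (card (Rng n f))) \<and>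
         measure_pmf.expectation (unif_Hom n d) (\<lambda>f. real (card (Rng n f)))
           \<le> 3 + C * sqrt (real n / 2 ^ d))"
  proof (rule exI[of _ 4], rule exI[of _ "1 / 48000"], intro conjI allI impI)
    fix n d :: nat assume n: "n > 0" and d: "d > 0"
    show "measure_pmf.expectation (unif_Hom n d) (\<lambda>f. real (card (Rng n f))) \<le> 3 + 4 * sqrt (real n / 2 ^ d)"
      by (rule expectation_le[OF n d])
    define q where "q = sqrt (real n / 2 ^ d)"
    \<comment> \<open>With \<open>\<delta> = 1 / 24000\<close> the tail bound gives
      \<open>1 / 8 + 1 / 8\<close> once \<open>F\<close> is nonzero. Half of \<open>F\<close> then
      survives, which is why \<open>c\<close> is half of \<open>\<delta>\<close>.\<close>
    define F where "F = \<lfloor>1 / 24000 * q\<rfloor>"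
    define p where "p = measure_pmf.prob (unif_Hom n d) {f. real (card (Rng n f)) < 3 + real_of_int F}"
    have "0 \<le> q" by (simp add: q_def)
    then have F: "0 \<le> F" by (simp add: F_def)
    have cF: "real_of_int \<lfloor>1 / 48000 * q\<rfloor> \<le> real_of_int F / 2"
    proof -
      have "real_of_int (2 * \<lfloor>1 / 48000 * q\<rfloor>) \<le> 1 / 24000 * q"
        using of_int_floor_le[of "1 / 48000 * q"] by simp
      then have "2 * \<lfloor>1 / 48000 * q\<rfloor> \<le> F" unfolding F_def by (simp only: le_floor_iff)
      then show ?thesis by linarith
    qed
    have "real_of_int F / 2 \<le> real_of_int F * (1 - p)"
    proof (cases "F = 0")
      case False
      then have "24000 \<le> q" using F unfolding F_def by linarith
      then have "24000\<^sup>2 \<le> q\<^sup>2" by (intro power_mono) auto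
      then have "24000\<^sup>2 \<le> real n / 2 ^ d" by (simp add: q_def)
      also have "\<dots> \<le> real n / 1" by (intro divide_left_mono) auto
      finally have "8 \<le> real n" by simp
      then have "2 powr (1 - real n / 2) \<le> 2 powr (-3)" by (intro powr_mono) auto
      also have "\<dots> = 1 / 8" by (simp add: powr_minus powr_numeral)
      finally have "p \<le> 1 / 2"
        using prob_lt[OF n d, of "1 / 24000"] unfolding p_def F_def q_def by simp
      then have "real_of_int F * (1 / 2) \<le> real_of_int F * (1 - p)" using F by (intro mult_left_mono) auto
      then show ?thesis by simp
    qed simp
    then show "3 + real_of_int \<lfloor>1 / 48000 * sqrt (real n / 2 ^ d)\<rfloor> - 2 powr (1 - real n / 2)
        \<le> measure_pmf.expectation (unif_Hom n d) (\<lambda>f. real (card (Rng n f)))"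
      using expectation_ge[OF n F, of d] prob_lt_3[OF n d] cF unfolding q_def[symmetric] p_def by linarith
  qed auto
next
  fix \<epsilon> :: real assume \<epsilon>: "\<epsilon> > 0"
  show "\<exists>\<delta> > 0. \<forall>n d :: nat. n > 0 \<longrightarrow> d > 0 \<longrightarrow>
      measure_pmf.prob (unif_Hom n d)
        {f. real (card (Rng n f)) < 3 + real_of_int \<lfloor>\<delta> * sqrt (real n / 2 ^ d)\<rfloor>}
      \<le> \<epsilon> + 2 powr (1 - real n / 2)"
  proof (intro exI[of _ "min (1 / 2) (\<epsilon> / 3000)"] conjI allI impI)
    fix n d :: nat assume n: "n > 0" and d: "d > 0"
    define \<delta> where "\<delta> = min (1 / 2) (\<epsilon> / 3000)"
    have \<delta>: "0 < \<delta>" "\<delta> \<le> 1 / 2" "3000 * \<delta> \<le> \<epsilon>" using \<epsilon> by (auto simp: \<delta>_def)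
    show "measure_pmf.prob (unif_Hom n d)
        {f. real (card (Rng n f)) < 3 + real_of_int \<lfloor>min (1 / 2) (\<epsilon> / 3000) * sqrt (real n / 2 ^ d)\<rfloor>}
      \<le> \<epsilon> + 2 powr (1 - real n / 2)"
      using prob_lt[OF n d \<delta>(1,2)] \<delta>(3) unfolding \<delta>_def[symmetric] by linarith
  qed (use \<epsilon> in auto)
next
  fix d :: "nat \<Rightarrow> nat" and r :: nat
  assume d: "\<forall>n > 0. d n > 0" and r: "r > 0"
    and lim: "filterlim (\<lambda>n. real (d n) - log 2 (real n)) at_bot sequentially"
  show "(\<lambda>n. measure_pmf.prob (unif_Hom n (d n)) {f. card (Rng n f) \<le> r}) \<longlonglongrightarrow> 0"
  proof (rule tendstoI)
    fix e :: real assume e: "e > 0"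
    define \<delta> where "\<delta> = min (1 / 2) (e / 9000)"
    have \<delta>: "0 < \<delta>" "\<delta> \<le> 1 / 2" "3000 * \<delta> \<le> e / 3" using e by (auto simp: \<delta>_def)
    have "((\<lambda>n. 2 powr (1 - real n / 2)) \<longlongrightarrow> 0) sequentially" by real_asymp
    then have "\<forall>\<^sub>F n in sequentially. 2 powr (1 - real n / 2) < e / 3"
      using e by (intro order_tendstoD) auto
    \<comment> \<open>This threshold is equivalent to
      \<open>r \<le> \<delta> * sqrt (n / 2 ^ d n)\<close>, which places the event inside that of
      \<open>prob_lt\<close>.\<close>
    moreover have "\<forall>\<^sub>F n in sequentially. real (d n) - log 2 (real n) \<le> - log 2 ((real r / \<delta>)\<^sup>2)"
      using lim by (simp add: filterlim_at_bot)
    moreover have "\<forall>\<^sub>F n in sequentially. n > 0" by (rule eventually_gt_at_top)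
    ultimately show "\<forall>\<^sub>F n in sequentially.
        dist (measure_pmf.prob (unif_Hom n (d n)) {f. card (Rng n f) \<le> r}) 0 < e"
    proof eventually_elim
      case (elim n)
      define Y where "Y = real n / 2 ^ d n"
      have "(real r / \<delta>)\<^sup>2 = 2 powr log 2 ((real r / \<delta>)\<^sup>2)" using r \<delta> by simp
      also have "\<dots> \<le> 2 powr (log 2 (real n) - real (d n))" using elim by (intro powr_mono) auto
      also have "\<dots> = Y" using elim by (simp add: powr_diff powr_realpow Y_def)
      finally have "real r / \<delta> \<le> sqrt Y" by (rule real_le_rsqrt)
      then have "real r \<le> \<delta> * sqrt Y" using \<delta> by (simp add: field_simps)
      then have "int r \<le> \<lfloor>\<delta> * sqrt Y\<rfloor>" by (simp add: le_floor_iff)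
      then have "{f. card (Rng n f) \<le> r} \<subseteq> {f. real (card (Rng n f)) < 3 + real_of_int \<lfloor>\<delta> * sqrt Y\<rfloor>}"
        by auto
      then have "measure_pmf.prob (unif_Hom n (d n)) {f. card (Rng n f) \<le> r} \<le>
          measure_pmf.prob (unif_Hom n (d n)) {f. real (card (Rng n f)) < 3 + real_of_int \<lfloor>\<delta> * sqrt Y\<rfloor>}"
        by (intro measure_pmf.finite_measure_mono) auto
      also have "\<dots> \<le> 3000 * \<delta> + 2 powr (1 - real n / 2)"
        unfolding Y_def using elim d \<delta> by (intro prob_lt) auto
      also have "\<dots> < e" using elim \<delta> e by linarith
      finally show ?case by simp
    qed
  qed
qed

end
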